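(* Let $V$ be a vector space, let $k_1,l_1,k_2,l_2\ge 0$ be integers, and let $\Psi_1\colon V^{\otimes k_1}\to V^{\otimes l_1}$ and $\Psi_2\colon V^{\otimes k_2}\to V^{\otimes l_2}$ be linear maps. Then there exist linear maps $\Psi_{3,s}\colon V^{\otimes(k_1+k_2-s)}\to V^{\otimes(l_1+l_2-s)}$, for integers $0\le s\le \min(k_1+k_2,\,l_1+l_2)$, such that $$ i(\Psi_1)\circ i(\Psi_2)-i(\Psi_2)\circ i(\Psi_1)=i\Bigl(\sum_{s\ge 0}\Psi_{3,s}\Bigr):=\sum_{s\ge0} i(\Psi_{3,s}) $$ as maps $V^{\otimes N}\to V^{\otimes (N-k_1-k_2+l_1+l_2)}$ for all sufficiently large $N$.
   Context: For a linear map $\Psi\colon V^{\otimes k}\to V^{\otimes l}$ ($k,l\ge 0$, with $V^{\otimes 0}$ the ground field) and each sufficiently large $N$ (at least $N\ge k$), the map $i(\Psi)\colon V^{\otimes N}\to V^{\otimes (N-k+l)}$ is defined by applying $\Psi$ to every block of $k$ consecutive tensor factors and summing: $$ i(\Psi)(v_1\otimes\cdots\otimes v_N)=\sum_{j=0}^{N-k} v_1\otimes\cdots\otimes v_j\otimes \Psi(v_{j+1}\otimes\cdots\otimes v_{j+k})\otimes v_{j+k+1}\otimes\cdots\otimes v_N . $$ When $k=0$, $\Psi$ is given by an element $\Psi(1)\in V^{\otimes l}$, and the sum runs over the $N+1$ positions at which this element can be inserted. The map $i$ is extended by linearity to finite sums of maps $V^{\otimes k}\to V^{\otimes l}$ with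 different $k,l$ having the same value of $k-l$. There are no signs: $V$ is an ungraded vector space. *)

theory Defs
  imports Complex_Main "HOL-Library.Poly_Mapping" "HOL-Library.FuncSet"
begin

section \<open>Tensor powers of a vector space\<close>

text \<open>
  \<open>V\<close> is the type \<open>'b\<close> with scalar multiplication \<open>scale\<close> over the field \<open>'a\<close>. The \<open>n\<close>-th tensor
  power is the usual quotient of the free vector space on \<open>V\<^sup>n\<close> (formal linear combinations of
  lists of length \<open>n\<close>) by the multilinearity relations. As the quotient depends on the term
  \<open>scale\<close> and on \<open>n\<close>, it is a set of equivalence classes rather than a type. For \<open>n = 0\<close> there
  are no relations, and the quotient is the ground field, with the class of the empty list as \<open>1\<close>.
\<close>

definition free_scale :: "'a::field \<Rightarrow> ('c \<Rightarrow>\<^sub>0 'a) \<Rightarrow> ('c \<Rightarrow>\<^sub>0 'a)" where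
  "free_scale c p = Poly_Mapping.map ((*) c) p"

lemma lookup_free_scale [simp]: "Poly_Mapping.lookup (free_scale c p) x = c * Poly_Mapping.lookup p x"
  unfolding free_scale_def by transfer (auto simp: when_def)

interpretation free: vector_space free_scale
  by unfold_locales (auto intro!: poly_mapping_eqI simp: lookup_add algebra_simps)

definition free_tensors :: "nat \<Rightarrow> ('b list \<Rightarrow>\<^sub>0 'a::field) set" where
  "free_tensors n = {p. Poly_Mapping.keys p \<subseteq> {xs. length xs = n}}"

definition multilinear_relations ::
    "('a::field \<Rightarrow> 'b::ab_group_add \<Rightarrow> 'b) \<Rightarrow> nat \<Rightarrow> ('b list \<Rightarrow>\<^sub>0 'a) set" where
  "multilinear_relations scale n =
     {Poly_Mapping.single (us @ (x + y) # ws) 1 - Poly_Mapping.single (us @ x # ws) 1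
        - Poly_Mapping.single (us @ y # ws) 1 | us x y ws. length (us @ x # ws) = n} \<union>
     {Poly_Mapping.single (us @ scale c x # ws) 1
        - free_scale c (Poly_Mapping.single (us @ x # ws) 1) | us c x ws. length (us @ x # ws) = n}"

definition tensor_rel ::
    "('a::field \<Rightarrow> 'b::ab_group_add \<Rightarrow> 'b) \<Rightarrow> nat \<Rightarrow> ('b list \<Rightarrow>\<^sub>0 'a) rel" where
  "tensor_rel scale n =
     {(p, q). p \<in> free_tensors n \<and> q \<in> free_tensors n \<and>
        p - q \<in> free.span (multilinear_relations scale n)}"

definition tensor_power ::
    "('a::field \<Rightarrow> 'b::ab_group_add \<Rightarrow> 'b) \<Rightarrow> nat \<Rightarrow> ('b list \<Rightarrow>\<^sub>0 'a) set set" where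
  "tensor_power scale n = free_tensors n // tensor_rel scale n"

definition tensor_class ::
    "('a::field \<Rightarrow> 'b::ab_group_add \<Rightarrow> 'b) \<Rightarrow> nat \<Rightarrow> ('b list \<Rightarrow>\<^sub>0 'a) \<Rightarrow> ('b list \<Rightarrow>\<^sub>0 'a) set" where
  "tensor_class scale n p = tensor_rel scale n `` {p}"

text \<open>The pure tensor \<open>v\<^sub>1 \<otimes> \<dots> \<otimes> v\<^sub>n\<close> of a list of vectors.\<close>

definition pure_tensor ::
    "('a::field \<Rightarrow> 'b::ab_group_add \<Rightarrow> 'b) \<Rightarrow> 'b list \<Rightarrow> ('b list \<Rightarrow>\<^sub>0 'a) set" where
  "pure_tensor scale vs = tensor_class scale (length vs) (Poly_Mapping.single vs 1)"

text \<open>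
  The operations take the degree \<open>n\<close> of their arguments as a parameter; the unions are over
  representatives, and all of their members coincide on \<open>tensor_power scale n\<close>.
\<close>

definition tensor_add ::
    "('a::field \<Rightarrow> 'b::ab_group_add \<Rightarrow> 'b) \<Rightarrow> nat \<Rightarrow>
       ('b list \<Rightarrow>\<^sub>0 'a) set \<Rightarrow> ('b list \<Rightarrow>\<^sub>0 'a) set \<Rightarrow> ('b list \<Rightarrow>\<^sub>0 'a) set" where
  "tensor_add scale n A B = (\<Union>p\<in>A. \<Union>q\<in>B. tensor_class scale n (p + q))"

definition tensor_scale ::
    "('a::field \<Rightarrow> 'b::ab_group_add \<Rightarrow> 'b) \<Rightarrow> nat \<Rightarrow>
       'a \<Rightarrow> ('b list \<Rightarrow>\<^sub>0 'a) set \<Rightarrow> ('b list \<Rightarrow>\<^sub>0 'a) set" where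
  "tensor_scale scale n c A = (\<Union>p\<in>A. tensor_class scale n (free_scale c p))"

definition tensor_diff ::
    "('a::field \<Rightarrow> 'b::ab_group_add \<Rightarrow> 'b) \<Rightarrow> nat \<Rightarrow>
       ('b list \<Rightarrow>\<^sub>0 'a) set \<Rightarrow> ('b list \<Rightarrow>\<^sub>0 'a) set \<Rightarrow> ('b list \<Rightarrow>\<^sub>0 'a) set" where
  "tensor_diff scale n A B = (\<Union>p\<in>A. \<Union>q\<in>B. tensor_class scale n (p - q))"

text \<open>\<open>tensor_sum scale n f m\<close> is the sum of the tensors \<open>f j\<close> over all \<open>j < m\<close>.\<close>

primrec tensor_sum ::
    "('a::field \<Rightarrow> 'b::ab_group_add \<Rightarrow> 'b) \<Rightarrow> nat \<Rightarrow>
       (nat \<Rightarrow> ('b list \<Rightarrow>\<^sub>0 'a) set) \<Rightarrow> nat \<Rightarrow> ('b list \<Rightarrow>\<^sub>0 'a) set" where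
  "tensor_sum scale n f 0 = tensor_class scale n 0"
| "tensor_sum scale n f (Suc m) = tensor_add scale n (tensor_sum scale n f m) (f m)"

definition free_mult ::
    "('b list \<Rightarrow>\<^sub>0 'a::field) \<Rightarrow> ('b list \<Rightarrow>\<^sub>0 'a) \<Rightarrow> ('b list \<Rightarrow>\<^sub>0 'a)" where
  "free_mult p q =
     (\<Sum>xs\<in>Poly_Mapping.keys p. \<Sum>ys\<in>Poly_Mapping.keys q. Poly_Mapping.single (xs @ ys) (Poly_Mapping.lookup p xs * Poly_Mapping.lookup q ys))"

text \<open>The product \<open>V\<^sup>\<otimes>\<^sup>m \<times> V\<^sup>\<otimes>\<^sup>n \<rightarrow> V\<^sup>\<otimes>\<^sup>(\<^sup>m\<^sup>+\<^sup>n\<^sup>)\<close> given by concatenation of pure tensors.\<close>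

definition tensor_mult ::
    "('a::field \<Rightarrow> 'b::ab_group_add \<Rightarrow> 'b) \<Rightarrow> nat \<Rightarrow> nat \<Rightarrow>
       ('b list \<Rightarrow>\<^sub>0 'a) set \<Rightarrow> ('b list \<Rightarrow>\<^sub>0 'a) set \<Rightarrow> ('b list \<Rightarrow>\<^sub>0 'a) set" where
  "tensor_mult scale m n A B = (\<Union>p\<in>A. \<Union>q\<in>B. tensor_class scale (m + n) (free_mult p q))"

definition tensor_linear ::
    "('a::field \<Rightarrow> 'b::ab_group_add \<Rightarrow> 'b) \<Rightarrow> nat \<Rightarrow> nat \<Rightarrow>
       (('b list \<Rightarrow>\<^sub>0 'a) set \<Rightarrow> ('b list \<Rightarrow>\<^sub>0 'a) set) \<Rightarrow> bool" where
  "tensor_linear scale k l f \<longleftrightarrow>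
     f \<in> tensor_power scale k \<rightarrow> tensor_power scale l \<and>
     (\<forall>A\<in>tensor_power scale k. \<forall>B\<in>tensor_power scale k.
        f (tensor_add scale k A B) = tensor_add scale l (f A) (f B)) \<and>
     (\<forall>c. \<forall>A\<in>tensor_power scale k. f (tensor_scale scale k c A) = tensor_scale scale l c (f A))"


section \<open>The maps \<open>i(\<Psi>)\<close>\<close>

text \<open>
  \<open>block_term scale k l \<Psi> j vs\<close> is
  \<open>v\<^sub>1 \<otimes> \<dots> \<otimes> v\<^sub>j \<otimes> \<Psi>(v\<^sub>j\<^sub>+\<^sub>1 \<otimes> \<dots> \<otimes> v\<^sub>j\<^sub>+\<^sub>k) \<otimes> v\<^sub>j\<^sub>+\<^sub>k\<^sub>+\<^sub>1 \<otimes> \<dots> \<otimes> v\<^sub>N\<close>.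
\<close>

definition block_term ::
    "('a::field \<Rightarrow> 'b::ab_group_add \<Rightarrow> 'b) \<Rightarrow> nat \<Rightarrow> nat \<Rightarrow>
       (('b list \<Rightarrow>\<^sub>0 'a) set \<Rightarrow> ('b list \<Rightarrow>\<^sub>0 'a) set) \<Rightarrow> nat \<Rightarrow> 'b list \<Rightarrow> ('b list \<Rightarrow>\<^sub>0 'a) set" where
  "block_term scale k l \<Psi> j vs =
     tensor_mult scale (j + l) (length vs - k - j)
       (tensor_mult scale j l (pure_tensor scale (take j vs))
          (\<Psi> (pure_tensor scale (take k (drop j vs)))))
       (pure_tensor scale (drop (j + k) vs))"

text \<open>
  The map \<open>i(\<Psi>)\<close> on \<open>V\<^sup>\<otimes>\<^sup>N\<close>, for \<open>\<Psi>\<close> from \<open>V\<^sup>\<otimes>\<^sup>k\<close> to \<open>V\<^sup>\<otimes>\<^sup>l\<close> and \<open>k \<le> N\<close>: the linear map with the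
  prescribed values on pure tensors. It exists and is unique by \<open>insertion_ex1\<close> below.
\<close>

definition insertion ::
    "('a::field \<Rightarrow> 'b::ab_group_add \<Rightarrow> 'b) \<Rightarrow> nat \<Rightarrow> nat \<Rightarrow>
       (('b list \<Rightarrow>\<^sub>0 'a) set \<Rightarrow> ('b list \<Rightarrow>\<^sub>0 'a) set) \<Rightarrow> nat \<Rightarrow>
       ('b list \<Rightarrow>\<^sub>0 'a) set \<Rightarrow> ('b list \<Rightarrow>\<^sub>0 'a) set" where
  "insertion scale k l \<Psi> N =
     (THE f. f \<in> extensional (tensor_power scale N) \<and> tensor_linear scale N (N - k + l) f \<and>
        (\<forall>vs. length vs = N \<longrightarrow>
           f (pure_tensor scale vs) =
             tensor_sum scale (N - k + l) (\<lambda>j. block_term scale k l \<Psi> j vs) (N - k + 1)))"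


section \<open>Well-definedness\<close>

subsection \<open>Free vector spaces\<close>

definition free_ext :: "('c \<Rightarrow> ('d \<Rightarrow>\<^sub>0 'a::field)) \<Rightarrow> ('c \<Rightarrow>\<^sub>0 'a) \<Rightarrow> ('d \<Rightarrow>\<^sub>0 'a)" where
  "free_ext g p = (\<Sum>x\<in>Poly_Mapping.keys p. free_scale (Poly_Mapping.lookup p x) (g x))"

lemma free_ext_superset:
  assumes "finite S" "Poly_Mapping.keys p \<subseteq> S"
  shows "free_ext g p = (\<Sum>x\<in>S. free_scale (Poly_Mapping.lookup p x) (g x))"
  unfolding free_ext_def using assms
  by (intro sum.mono_neutral_left) (auto simp: in_keys_iff)

lemma free_ext_add: "free_ext g (p + q) = free_ext g p + free_ext g q"
proof -
  have "Poly_Mapping.keys (p + q) \<subseteq> Poly_Mapping.keys p \<union> Poly_Mapping.keys q" by (rule keys_add)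
  then show ?thesis
    by (simp add: free_ext_superset[of "Poly_Mapping.keys p \<union> Poly_Mapping.keys q" _ g]
        lookup_add free.scale_left_distrib sum.distrib)
qed

lemma free_ext_scale: "free_ext g (free_scale c p) = free_scale c (free_ext g p)"
proof -
  have "Poly_Mapping.keys (free_scale c p) \<subseteq> Poly_Mapping.keys p" by (auto simp: in_keys_iff)
  then have "free_ext g (free_scale c p) =
      (\<Sum>x\<in>Poly_Mapping.keys p. free_scale (Poly_Mapping.lookup (free_scale c p) x) (g x))"
    by (intro free_ext_superset) auto
  then show ?thesis
    by (simp add: free_ext_def free.scale_sum_right)
qed

lemma linear_free_ext: "Vector_Spaces.linear free_scale free_scale (free_ext g)"
  by unfold_locales (simp_all add: free_ext_add free_ext_scale)

lemma free_ext_single [simp]: "free_ext g (Poly_Mapping.single x 1) = g x"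
  by (simp add: free_ext_def)

lemma free_scale_single [simp]:
  "free_scale c (Poly_Mapping.single x d) = Poly_Mapping.single x (c * d)"
  by (intro poly_mapping_eqI) (auto simp: lookup_single when_def)

lemma poly_mapping_sum_singles: "(\<Sum>x\<in>Poly_Mapping.keys p. Poly_Mapping.single x (Poly_Mapping.lookup p x)) = p"
proof (intro poly_mapping_eqI)
  fix k
  have "Poly_Mapping.lookup (\<Sum>x\<in>Poly_Mapping.keys p. Poly_Mapping.single x (Poly_Mapping.lookup p x)) k =
      (\<Sum>x\<in>Poly_Mapping.keys p. if x = k then Poly_Mapping.lookup p x else 0)"
    by (simp add: lookup_sum lookup_single when_def)
  also have "\<dots> = Poly_Mapping.lookup p k" by (auto simp: in_keys_iff)
  finally show "Poly_Mapping.lookup (\<Sum>x\<in>Poly_Mapping.keys p. Poly_Mapping.single x (Poly_Mapping.lookup p x)) k = Poly_Mapping.lookup p k" .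
qed

lemma subspace_free_tensors: "free.subspace (free_tensors n :: ('b list \<Rightarrow>\<^sub>0 'a::field) set)"
proof (rule free.subspaceI)
  fix p q :: "'b list \<Rightarrow>\<^sub>0 'a"
  assume "p \<in> free_tensors n" "q \<in> free_tensors n"
  then show "p + q \<in> free_tensors n"
    using keys_add[of p q] by (auto simp: free_tensors_def)
qed (auto simp: free_tensors_def in_keys_iff)

lemma single_in_free_tensors: "length xs = n \<Longrightarrow> Poly_Mapping.single xs c \<in> free_tensors n"
  by (simp add: free_tensors_def)

lemma free_tensors_eq_span:
  "(free_tensors n :: ('b list \<Rightarrow>\<^sub>0 'a::field) set) =
     free.span {Poly_Mapping.single xs 1 | xs. length xs = n}"
proof
  show "free.span {Poly_Mapping.single xs 1 | xs. length xs = n} \<subseteq>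
      (free_tensors n :: ('b list \<Rightarrow>\<^sub>0 'a) set)"
    by (intro free.span_minimal subspace_free_tensors) (auto intro: single_in_free_tensors)
  show "(free_tensors n :: ('b list \<Rightarrow>\<^sub>0 'a) set) \<subseteq>
      free.span {Poly_Mapping.single xs 1 | xs. length xs = n}"
  proof
    fix p :: "'b list \<Rightarrow>\<^sub>0 'a" assume p: "p \<in> free_tensors n"
    have "(\<Sum>x\<in>Poly_Mapping.keys p. free_scale (Poly_Mapping.lookup p x) (Poly_Mapping.single x 1)) \<in>
        free.span {Poly_Mapping.single xs 1 | xs. length xs = n}"
      using p by (intro free.span_sum free.span_scale free.span_base) (auto simp: free_tensors_def)
    then show "p \<in> free.span {Poly_Mapping.single xs 1 | xs. length xs = n}"
      by (simp add: poly_mapping_sum_singles)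
  qed
qed

lemma free_tensors_induct:
  assumes "p \<in> free_tensors n" "free.subspace {p. P p}"
    and "\<And>xs. length xs = n \<Longrightarrow> P (Poly_Mapping.single xs 1)"
  shows "P p"
  using free.span_induct[of p "{Poly_Mapping.single xs 1 | xs. length xs = n}" P] assms
  by (auto simp: free_tensors_eq_span)

lemma free_mult_eq_ext:
  "free_mult p q = free_ext (\<lambda>xs. free_ext (\<lambda>ys. Poly_Mapping.single (xs @ ys) 1) q) p"
  by (simp add: free_mult_def free_ext_def free.scale_sum_right)

lemma free_mult_eq_ext':
  "free_mult p q = free_ext (\<lambda>ys. free_ext (\<lambda>xs. Poly_Mapping.single (xs @ ys) 1) p) q"
  unfolding free_mult_def
  by (subst sum.swap) (simp add: free_ext_def free.scale_sum_right mult.commute)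

lemma linear_free_mult_left: "Vector_Spaces.linear free_scale free_scale (\<lambda>p. free_mult p q)"
  unfolding free_mult_eq_ext by (rule linear_free_ext)

lemma linear_free_mult_right: "Vector_Spaces.linear free_scale free_scale (\<lambda>q. free_mult p q)"
  unfolding free_mult_eq_ext' by (rule linear_free_ext)

lemma free_mult_single [simp]:
  "free_mult (Poly_Mapping.single xs 1) (Poly_Mapping.single ys 1) = Poly_Mapping.single (xs @ ys) 1"
  by (simp add: free_mult_eq_ext)

lemma linear_image_span:
  assumes "Vector_Spaces.linear free_scale free_scale f" "free.subspace T"
    and "\<And>r. r \<in> S \<Longrightarrow> f r \<in> T" "p \<in> free.span S"
  shows "f p \<in> T"
proof -
  interpret f: Vector_Spaces.linear free_scale free_scale f by fact
  have "free.subspace {p. f p \<in> T}"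
    using assms(2) by (auto simp: free.subspace_def f.add f.scale f.zero)
  then show ?thesis
    using free.span_induct[OF assms(4)] assms(3) by blast
qed

lemma free_mult_closed:
  assumes "p \<in> free_tensors m" "q \<in> free_tensors n"
  shows "free_mult p q \<in> free_tensors (m + n)"
proof -
  have "length xs = m" if "xs \<in> Poly_Mapping.keys p" for xs
    using that assms(1) by (auto simp: free_tensors_def)
  moreover have "length ys = n" if "ys \<in> Poly_Mapping.keys q" for ys
    using that assms(2) by (auto simp: free_tensors_def)
  ultimately show ?thesis
    unfolding free_mult_def
    by (intro free.subspace_sum subspace_free_tensors single_in_free_tensors) auto
qed


subsection \<open>Null tensors\<close>

abbreviation null_tensors ::
    "('a::field \<Rightarrow> 'b::ab_group_add \<Rightarrow> 'b) \<Rightarrow> nat \<Rightarrow> ('b list \<Rightarrow>\<^sub>0 'a) set" where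
  "null_tensors scale n \<equiv> free.span (multilinear_relations scale n)"

lemma relation_add:
  "length us + length ws + 1 = n \<Longrightarrow>
     Poly_Mapping.single (us @ (x + y) # ws) 1 - Poly_Mapping.single (us @ x # ws) 1
       - Poly_Mapping.single (us @ y # ws) 1 \<in> multilinear_relations scale n"
  unfolding multilinear_relations_def by (rule UnI1) force

lemma relation_scale:
  "length us + length ws + 1 = n \<Longrightarrow>
     Poly_Mapping.single (us @ scale c x # ws) 1 - Poly_Mapping.single (us @ x # ws) c
       \<in> multilinear_relations scale n"
  unfolding multilinear_relations_def by (rule UnI2) force

lemma multilinear_relations_cases:
  assumes "r \<in> multilinear_relations scale n"
  obtains (add) us x y ws where "length us + length ws + 1 = n"
      "r = Poly_Mapping.single (us @ (x + y) # ws) 1 - Poly_Mapping.single (us @ x # ws) 1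
        - Poly_Mapping.single (us @ y # ws) 1"
  | (scale) us c x ws where "length us + length ws + 1 = n"
      "r = Poly_Mapping.single (us @ scale c x # ws) 1
        - free_scale c (Poly_Mapping.single (us @ x # ws) 1)"
  using assms unfolding multilinear_relations_def by force

lemma null_tensors_subset: "null_tensors scale n \<subseteq> free_tensors n"
proof (rule free.span_minimal[OF _ subspace_free_tensors], rule subsetI)
  fix r assume "r \<in> multilinear_relations scale n"
  then show "r \<in> free_tensors n"
    by (cases rule: multilinear_relations_cases)
      (auto intro!: free.subspace_diff subspace_free_tensors free.subspace_scale
        single_in_free_tensors)
qed

lemma free_mult_null_left:
  fixes scale :: "'a::field \<Rightarrow> 'b::ab_group_add \<Rightarrow> 'b"
  assumes "p \<in> null_tensors scale m" "q \<in> free_tensors n"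
  shows "free_mult p q \<in> null_tensors scale (m + n)"
proof (rule linear_image_span[OF linear_free_mult_left free.subspace_span _ assms(1)])
  fix r assume r: "r \<in> multilinear_relations scale m"
  interpret R: Vector_Spaces.linear free_scale free_scale "\<lambda>q. free_mult r q"
    by (rule linear_free_mult_right)
  show "free_mult r q \<in> null_tensors scale (m + n)"
    using assms(2)
  proof (rule free_tensors_induct)
    show "free.subspace {q. free_mult r q \<in> null_tensors scale (m + n)}"
      by (auto simp: free.subspace_def R.add R.scale R.zero
          intro: free.span_add free.span_scale free.span_zero)
    fix ys :: "'b list" assume ys: "length ys = n"
    interpret L: Vector_Spaces.linear free_scale free_scale
      "\<lambda>p. free_mult p (Poly_Mapping.single ys (1::'a))"
      by (rule linear_free_mult_left)
    have "free_mult r (Poly_Mapping.single ys 1) \<in> multilinear_relations scale (m + n)"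
      using r
    proof (cases rule: multilinear_relations_cases)
      case (add us x y ws)
      then show ?thesis using ys relation_add[of us "ws @ ys" "m + n" x y scale]
        by (simp add: L.diff)
    next
      case (scale us c x ws)
      then show ?thesis using ys relation_scale[of us "ws @ ys" "m + n" scale c x]
        by (simp only: L.diff L.scale) simp
    qed
    then show "free_mult r (Poly_Mapping.single ys 1) \<in> null_tensors scale (m + n)"
      by (rule free.span_base)
  qed
qed

lemma free_mult_null_right:
  fixes scale :: "'a::field \<Rightarrow> 'b::ab_group_add \<Rightarrow> 'b"
  assumes "p \<in> free_tensors m" "q \<in> null_tensors scale n"
  shows "free_mult p q \<in> null_tensors scale (m + n)"
proof (rule linear_image_span[OF linear_free_mult_right free.subspace_span _ assms(2)])
  fix r assume r: "r \<in> multilinear_relations scale n"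
  interpret L: Vector_Spaces.linear free_scale free_scale "\<lambda>p. free_mult p r"
    by (rule linear_free_mult_left)
  show "free_mult p r \<in> null_tensors scale (m + n)"
    using assms(1)
  proof (rule free_tensors_induct)
    show "free.subspace {p. free_mult p r \<in> null_tensors scale (m + n)}"
      by (auto simp: free.subspace_def L.add L.scale L.zero
          intro: free.span_add free.span_scale free.span_zero)
    fix ys :: "'b list" assume ys: "length ys = m"
    interpret R: Vector_Spaces.linear free_scale free_scale
      "\<lambda>q. free_mult (Poly_Mapping.single ys (1::'a)) q"
      by (rule linear_free_mult_right)
    have "free_mult (Poly_Mapping.single ys 1) r \<in> multilinear_relations scale (m + n)"
      using r
    proof (cases rule: multilinear_relations_cases)
      case (add us x y ws)
      then show ?thesis using ys relation_add[of "ys @ us" ws "m + n" x y scale]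
        by (simp add: R.diff)
    next
      case (scale us c x ws)
      then show ?thesis using ys relation_scale[of "ys @ us" ws "m + n" scale c x]
        by (simp only: R.diff R.scale) simp
    qed
    then show "free_mult (Poly_Mapping.single ys 1) r \<in> null_tensors scale (m + n)"
      by (rule free.span_base)
  qed
qed


subsection \<open>Operations on classes\<close>

lemma equiv_tensor_rel: "equiv (free_tensors n) (tensor_rel scale n)"
proof (rule equivI)
  show "tensor_rel scale n \<subseteq> free_tensors n \<times> free_tensors n"
    by (auto simp: tensor_rel_def)
  show "refl_on (free_tensors n) (tensor_rel scale n)"
    by (auto simp: refl_on_def tensor_rel_def free.span_zero)
  show "sym (tensor_rel scale n)"
  proof (rule symI)
    fix p q assume "(p, q) \<in> tensor_rel scale n"
    then show "(q, p) \<in> tensor_rel scale n"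
      using free.span_neg[of "p - q"] by (auto simp: tensor_rel_def)
  qed
  show "trans (tensor_rel scale n)"
  proof (rule transI)
    fix p q r assume "(p, q) \<in> tensor_rel scale n" "(q, r) \<in> tensor_rel scale n"
    then show "(p, r) \<in> tensor_rel scale n"
      using free.span_add[of "p - q" _ "q - r"] by (auto simp: tensor_rel_def)
  qed
qed

lemma tensor_class_eq_iff:
  assumes "p \<in> free_tensors n" "q \<in> free_tensors n"
  shows "tensor_class scale n p = tensor_class scale n q \<longleftrightarrow> p - q \<in> null_tensors scale n"
  unfolding tensor_class_def eq_equiv_class_iff[OF equiv_tensor_rel assms]
  using assms by (simp add: tensor_rel_def)

lemma tensor_class_in_power: "p \<in> free_tensors n \<Longrightarrow> tensor_class scale n p \<in> tensor_power scale n"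
  unfolding tensor_class_def tensor_power_def by (rule quotientI)

lemma tensor_power_cases:
  assumes "A \<in> tensor_power scale n"
  obtains p where "p \<in> free_tensors n" "A = tensor_class scale n p"
  using assms unfolding tensor_class_def tensor_power_def by (rule quotientE)

lemma in_tensor_class:
  assumes "p \<in> free_tensors n"
  shows "q \<in> tensor_class scale n p \<longleftrightarrow> q \<in> free_tensors n \<and> p - q \<in> null_tensors scale n"
  using assms by (auto simp: tensor_class_def tensor_rel_def)

lemma tensor_class_self: "p \<in> free_tensors n \<Longrightarrow> p \<in> tensor_class scale n p"
  by (simp add: in_tensor_class free.span_zero)

lemma UN_tensor_class:
  assumes "p \<in> free_tensors n"
    and "\<And>p'. p' \<in> free_tensors n \<Longrightarrow> p - p' \<in> null_tensors scale n \<Longrightarrow> F p' = F p"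
  shows "(\<Union>p'\<in>tensor_class scale n p. F p') = F p"
proof -
  have "F p' = F p" if "p' \<in> tensor_class scale n p" for p'
    using that assms(1) by (intro assms(2)) (simp_all add: in_tensor_class)
  then show ?thesis
    using tensor_class_self[OF assms(1)] by blast
qed

lemma free_tensors_closed:
  "p \<in> free_tensors n \<Longrightarrow> q \<in> free_tensors n \<Longrightarrow> p + q \<in> free_tensors n"
  "p \<in> free_tensors n \<Longrightarrow> q \<in> free_tensors n \<Longrightarrow> p - q \<in> free_tensors n"
  "p \<in> free_tensors n \<Longrightarrow> free_scale c p \<in> free_tensors n"
  "0 \<in> free_tensors n"
  by (auto intro: free.subspace_add free.subspace_diff free.subspace_scale free.subspace_0
      subspace_free_tensors)

lemma tensor_add_class:
  assumes "p \<in> free_tensors n" "q \<in> free_tensors n"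
  shows "tensor_add scale n (tensor_class scale n p) (tensor_class scale n q) =
           tensor_class scale n (p + q)"
proof -
  have *: "tensor_class scale n (p' + q') = tensor_class scale n (p + q)"
    if "p' \<in> tensor_class scale n p" "q' \<in> tensor_class scale n q" for p' q'
  proof -
    have pq: "p' \<in> free_tensors n" "p - p' \<in> null_tensors scale n"
      "q' \<in> free_tensors n" "q - q' \<in> null_tensors scale n"
      using that assms by (auto simp: in_tensor_class)
    have "(p + q) - (p' + q') = (p - p') + (q - q')" by simp
    then have "(p + q) - (p' + q') \<in> null_tensors scale n"
      using pq by (metis free.span_add)
    then show ?thesis using pq assms
      by (metis free_tensors_closed(1) tensor_class_eq_iff)
  qed
  show ?thesis
    unfolding tensor_add_def using * assms[THEN tensor_class_self, of scale] by blast
qed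

lemma tensor_diff_class:
  assumes "p \<in> free_tensors n" "q \<in> free_tensors n"
  shows "tensor_diff scale n (tensor_class scale n p) (tensor_class scale n q) =
           tensor_class scale n (p - q)"
proof -
  have *: "tensor_class scale n (p' - q') = tensor_class scale n (p - q)"
    if "p' \<in> tensor_class scale n p" "q' \<in> tensor_class scale n q" for p' q'
  proof -
    have pq: "p' \<in> free_tensors n" "p - p' \<in> null_tensors scale n"
      "q' \<in> free_tensors n" "q - q' \<in> null_tensors scale n"
      using that assms by (auto simp: in_tensor_class)
    have "(p - q) - (p' - q') = (p - p') - (q - q')" by simp
    then have "(p - q) - (p' - q') \<in> null_tensors scale n"
      using pq by (metis free.span_diff)
    then show ?thesis using pq assms
      by (metis free_tensors_closed(2) tensor_class_eq_iff)
  qed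
  show ?thesis
    unfolding tensor_diff_def using * assms[THEN tensor_class_self, of scale] by blast
qed

lemma tensor_scale_class:
  assumes "p \<in> free_tensors n"
  shows "tensor_scale scale n c (tensor_class scale n p) = tensor_class scale n (free_scale c p)"
  unfolding tensor_scale_def
proof (rule UN_tensor_class[OF assms])
  fix p' assume "p' \<in> free_tensors n" "p - p' \<in> null_tensors scale n"
  then show "tensor_class scale n (free_scale c p') = tensor_class scale n (free_scale c p)"
    using assms free.span_scale[of "p - p'" _ c]
    by (metis free_tensors_closed(3) tensor_class_eq_iff free.scale_right_diff_distrib)
qed

lemma tensor_mult_class:
  assumes "p \<in> free_tensors m" "q \<in> free_tensors n"
  shows "tensor_mult scale m n (tensor_class scale m p) (tensor_class scale n q) =
           tensor_class scale (m + n) (free_mult p q)"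
proof -
  have *: "tensor_class scale (m + n) (free_mult p' q') = tensor_class scale (m + n) (free_mult p q)"
    if "p' \<in> tensor_class scale m p" "q' \<in> tensor_class scale n q" for p' q'
  proof -
    have pq: "p' \<in> free_tensors m" "p - p' \<in> null_tensors scale m"
      "q' \<in> free_tensors n" "q - q' \<in> null_tensors scale n"
      using that assms by (auto simp: in_tensor_class)
    interpret L: Vector_Spaces.linear free_scale free_scale "\<lambda>p. free_mult p q"
      by (rule linear_free_mult_left)
    interpret R: Vector_Spaces.linear free_scale free_scale "\<lambda>q. free_mult p' q"
      by (rule linear_free_mult_right)
    have "free_mult p q - free_mult p' q' = free_mult (p - p') q + free_mult p' (q - q')"
      by (simp add: L.diff R.diff)
    moreover have "free_mult (p - p') q \<in> null_tensors scale (m + n)"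
      using pq assms by (intro free_mult_null_left)
    moreover have "free_mult p' (q - q') \<in> null_tensors scale (m + n)"
      using pq assms by (intro free_mult_null_right)
    ultimately have "free_mult p q - free_mult p' q' \<in> null_tensors scale (m + n)"
      by (metis free.span_add)
    then show ?thesis using pq assms
      by (metis free_mult_closed tensor_class_eq_iff)
  qed
  show ?thesis
    unfolding tensor_mult_def
    using * tensor_class_self[OF assms(1), of scale] tensor_class_self[OF assms(2), of scale]
    by blast
qed

lemma tensor_add_closed:
  "A \<in> tensor_power scale n \<Longrightarrow> B \<in> tensor_power scale n \<Longrightarrow>
     tensor_add scale n A B \<in> tensor_power scale n"
  by (elim tensor_power_cases)
    (simp add: tensor_add_class tensor_class_in_power free_tensors_closed)

lemma tensor_scale_closed:
  "A \<in> tensor_power scale n \<Longrightarrow> tensor_scale scale n c A \<in> tensor_power scale n"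
  by (elim tensor_power_cases)
    (simp add: tensor_scale_class tensor_class_in_power free_tensors_closed)

lemma tensor_mult_closed:
  "A \<in> tensor_power scale m \<Longrightarrow> B \<in> tensor_power scale n \<Longrightarrow>
     tensor_mult scale m n A B \<in> tensor_power scale (m + n)"
  by (elim tensor_power_cases)
    (simp add: tensor_mult_class tensor_class_in_power free_mult_closed)

lemma pure_tensor_closed: "length vs = n \<Longrightarrow> pure_tensor scale vs \<in> tensor_power scale n"
  by (simp add: pure_tensor_def tensor_class_in_power single_in_free_tensors)

lemma tensor_mult_pure:
  "tensor_mult scale (length us) (length vs) (pure_tensor scale us) (pure_tensor scale vs) =
     pure_tensor scale (us @ vs)"
  by (simp add: pure_tensor_def tensor_mult_class single_in_free_tensors)

lemma tensor_mult_add_left: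
  assumes "A \<in> tensor_power scale m" "A' \<in> tensor_power scale m" "B \<in> tensor_power scale n"
  shows "tensor_mult scale m n (tensor_add scale m A A') B =
           tensor_add scale (m + n) (tensor_mult scale m n A B) (tensor_mult scale m n A' B)"
proof -
  obtain p p' q where [simp]: "p \<in> free_tensors m" "A = tensor_class scale m p"
    "p' \<in> free_tensors m" "A' = tensor_class scale m p'"
    "q \<in> free_tensors n" "B = tensor_class scale n q"
    using assms by (metis tensor_power_cases)
  interpret L: Vector_Spaces.linear free_scale free_scale "\<lambda>p. free_mult p q"
    by (rule linear_free_mult_left)
  show ?thesis
    by (simp add: tensor_add_class tensor_scale_class tensor_mult_class
        free_tensors_closed free_mult_closed L.add)
qed

lemma tensor_mult_add_right:
  assumes "A \<in> tensor_power scale m" "B \<in> tensor_power scale n" "B' \<in> tensor_power scale n"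
  shows "tensor_mult scale m n A (tensor_add scale n B B') =
           tensor_add scale (m + n) (tensor_mult scale m n A B) (tensor_mult scale m n A B')"
proof -
  obtain p q q' where [simp]: "p \<in> free_tensors m" "A = tensor_class scale m p"
    "q \<in> free_tensors n" "B = tensor_class scale n q"
    "q' \<in> free_tensors n" "B' = tensor_class scale n q'"
    using assms by (metis tensor_power_cases)
  interpret R: Vector_Spaces.linear free_scale free_scale "\<lambda>q. free_mult p q"
    by (rule linear_free_mult_right)
  show ?thesis
    by (simp add: tensor_add_class tensor_scale_class tensor_mult_class
        free_tensors_closed free_mult_closed R.add)
qed

lemma tensor_mult_scale_left:
  assumes "A \<in> tensor_power scale m" "B \<in> tensor_power scale n"
  shows "tensor_mult scale m n (tensor_scale scale m c A) B =
           tensor_scale scale (m + n) c (tensor_mult scale m n A B)"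
proof -
  obtain p q where [simp]: "p \<in> free_tensors m" "A = tensor_class scale m p"
    "q \<in> free_tensors n" "B = tensor_class scale n q"
    using assms by (metis tensor_power_cases)
  interpret L: Vector_Spaces.linear free_scale free_scale "\<lambda>p. free_mult p q"
    by (rule linear_free_mult_left)
  show ?thesis
    by (simp add: tensor_add_class tensor_scale_class tensor_mult_class
        free_tensors_closed free_mult_closed L.scale)
qed

lemma tensor_mult_scale_right:
  assumes "A \<in> tensor_power scale m" "B \<in> tensor_power scale n"
  shows "tensor_mult scale m n A (tensor_scale scale n c B) =
           tensor_scale scale (m + n) c (tensor_mult scale m n A B)"
proof -
  obtain p q where [simp]: "p \<in> free_tensors m" "A = tensor_class scale m p"
    "q \<in> free_tensors n" "B = tensor_class scale n q"
    using assms by (metis tensor_power_cases)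
  interpret R: Vector_Spaces.linear free_scale free_scale "\<lambda>q. free_mult p q"
    by (rule linear_free_mult_right)
  show ?thesis
    by (simp add: tensor_add_class tensor_scale_class tensor_mult_class
        free_tensors_closed free_mult_closed R.scale)
qed

lemmas tensor_mult_bilinear =
  tensor_mult_add_left tensor_mult_add_right tensor_mult_scale_left tensor_mult_scale_right

lemma pure_tensor_add:
  "pure_tensor scale (us @ (x + y) # ws) =
     tensor_add scale (length us + length ws + 1)
       (pure_tensor scale (us @ x # ws)) (pure_tensor scale (us @ y # ws))"
proof -
  let ?n = "length us + length ws + 1"
  have "Poly_Mapping.single (us @ (x + y) # ws) 1 -
      (Poly_Mapping.single (us @ x # ws) 1 + Poly_Mapping.single (us @ y # ws) 1)
      \<in> null_tensors scale ?n"
    using free.span_base[OF relation_add[of us ws ?n x y scale]] by (simp add: diff_diff_eq)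
  then have "tensor_class scale ?n (Poly_Mapping.single (us @ (x + y) # ws) 1) =
      tensor_class scale ?n
        (Poly_Mapping.single (us @ x # ws) 1 + Poly_Mapping.single (us @ y # ws) 1)"
    by (subst tensor_class_eq_iff) (auto intro!: free_tensors_closed single_in_free_tensors)
  then show ?thesis
    by (simp add: pure_tensor_def tensor_add_class single_in_free_tensors)
qed

lemma pure_tensor_scale:
  "pure_tensor scale (us @ scale c x # ws) =
     tensor_scale scale (length us + length ws + 1) c (pure_tensor scale (us @ x # ws))"
proof -
  let ?n = "length us + length ws + 1"
  have "tensor_class scale ?n (Poly_Mapping.single (us @ scale c x # ws) 1) =
      tensor_class scale ?n (Poly_Mapping.single (us @ x # ws) c)"
    using free.span_base[OF relation_scale[of us ws ?n scale c x]]
    by (subst tensor_class_eq_iff) (auto intro!: single_in_free_tensors)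
  then show ?thesis
    by (simp add: pure_tensor_def tensor_scale_class single_in_free_tensors)
qed

lemma tensor_sum_class:
  assumes "\<And>j. j < m \<Longrightarrow> p j \<in> free_tensors n \<and> f j = tensor_class scale n (p j)"
  shows "tensor_sum scale n f m = tensor_class scale n (\<Sum>j<m. p j)"
  using assms
proof (induction m)
  case (Suc m)
  have "(\<Sum>j<m. p j) \<in> free_tensors n"
    using Suc.prems by (intro free.subspace_sum subspace_free_tensors) auto
  then show ?case using Suc by (simp add: tensor_add_class)
qed simp

lemma tensor_sum_closed:
  "(\<And>j. j < m \<Longrightarrow> f j \<in> tensor_power scale n) \<Longrightarrow> tensor_sum scale n f m \<in> tensor_power scale n"
  by (induction m) (auto intro: tensor_add_closed tensor_class_in_power free_tensors_closed)

lemma tensor_family_cases: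
  assumes "\<And>j. j < m \<Longrightarrow> f j \<in> tensor_power scale n"
  obtains p where "\<forall>j<(m::nat). p j \<in> free_tensors n \<and> f j = tensor_class scale n (p j)"
    "(\<Sum>j<m. p j) \<in> free_tensors n" "tensor_sum scale n f m = tensor_class scale n (\<Sum>j<m. p j)"
proof -
  have "\<forall>j. \<exists>p. j < m \<longrightarrow> p \<in> free_tensors n \<and> f j = tensor_class scale n p"
    using assms by (metis tensor_power_cases)
  then obtain p where p: "\<And>j. j < m \<Longrightarrow> p j \<in> free_tensors n \<and> f j = tensor_class scale n (p j)"
    by metis
  show thesis
    using p by (intro that[of p] tensor_sum_class free.subspace_sum subspace_free_tensors) simp_all
qed

lemma tensor_sum_add:
  assumes "\<And>j. j < m \<Longrightarrow> f j \<in> tensor_power scale n" "\<And>j. j < m \<Longrightarrow> g j \<in> tensor_power scale n"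
  shows "tensor_sum scale n (\<lambda>j. tensor_add scale n (f j) (g j)) m =
           tensor_add scale n (tensor_sum scale n f m) (tensor_sum scale n g m)"
proof -
  obtain p where p: "\<forall>j<m. p j \<in> free_tensors n \<and> f j = tensor_class scale n (p j)"
    "(\<Sum>j<m. p j) \<in> free_tensors n" "tensor_sum scale n f m = tensor_class scale n (\<Sum>j<m. p j)"
    using assms(1) by (rule tensor_family_cases)
  obtain q where q: "\<forall>j<m. q j \<in> free_tensors n \<and> g j = tensor_class scale n (q j)"
    "(\<Sum>j<m. q j) \<in> free_tensors n" "tensor_sum scale n g m = tensor_class scale n (\<Sum>j<m. q j)"
    using assms(2) by (rule tensor_family_cases)
  have "tensor_sum scale n (\<lambda>j. tensor_add scale n (f j) (g j)) m =
      tensor_class scale n (\<Sum>j<m. p j + q j)"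
    by (rule tensor_sum_class) (use p(1) q(1) in \<open>auto simp: tensor_add_class free_tensors_closed\<close>)
  then show ?thesis
    using p(2,3) q(2,3) by (simp add: tensor_add_class sum.distrib)
qed

lemma tensor_sum_scale:
  assumes "\<And>j. j < m \<Longrightarrow> f j \<in> tensor_power scale n"
  shows "tensor_sum scale n (\<lambda>j. tensor_scale scale n c (f j)) m =
           tensor_scale scale n c (tensor_sum scale n f m)"
proof -
  obtain p where p: "\<forall>j<m. p j \<in> free_tensors n \<and> f j = tensor_class scale n (p j)"
    "(\<Sum>j<m. p j) \<in> free_tensors n" "tensor_sum scale n f m = tensor_class scale n (\<Sum>j<m. p j)"
    using assms by (rule tensor_family_cases)
  have "tensor_sum scale n (\<lambda>j. tensor_scale scale n c (f j)) m =
      tensor_class scale n (\<Sum>j<m. free_scale c (p j))"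
    by (rule tensor_sum_class) (use p(1) in \<open>auto simp: tensor_scale_class free_tensors_closed\<close>)
  then show ?thesis
    using p(2,3) by (simp add: tensor_scale_class free.scale_sum_right)
qed


subsection \<open>The universal property and \<open>i(\<Psi>)\<close>\<close>

lemma tensor_linear_eqI:
  fixes scale :: "'a::field \<Rightarrow> 'b::ab_group_add \<Rightarrow> 'b"
  assumes f: "tensor_linear scale n m f" and g: "tensor_linear scale n m g"
    and eq: "\<And>vs. length vs = n \<Longrightarrow> f (pure_tensor scale vs) = g (pure_tensor scale vs)"
    and A: "A \<in> tensor_power scale n"
  shows "f A = g A"
proof -
  obtain p where p: "p \<in> free_tensors n" "A = tensor_class scale n p"
    using A by (rule tensor_power_cases)
  have "p \<in> free_tensors n \<and> f (tensor_class scale n p) = g (tensor_class scale n p)"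
    using p(1)
  proof (rule free_tensors_induct)
    show "free.subspace {p. p \<in> free_tensors n \<and> f (tensor_class scale n p) = g (tensor_class scale n p)}"
      unfolding free.subspace_def
    proof (intro conjI ballI allI; clarsimp)
      have "tensor_class scale n 0 = tensor_scale scale n 0 (tensor_class scale n 0)"
        by (simp add: tensor_scale_class free_tensors_closed)
      moreover have z: "h (tensor_scale scale n 0 (tensor_class scale n 0)) = tensor_class scale m 0"
        if h: "tensor_linear scale n m h" for h
      proof -
        have c: "tensor_class scale n 0 \<in> tensor_power scale n"
          by (simp add: tensor_class_in_power free_tensors_closed)
        then have "h (tensor_class scale n 0) \<in> tensor_power scale m"
          using h by (auto simp: tensor_linear_def)
        then obtain q where "q \<in> free_tensors m" "h (tensor_class scale n 0) = tensor_class scale m q"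
          by (rule tensor_power_cases)
        then show ?thesis using h c by (simp add: tensor_linear_def tensor_scale_class)
      qed
      ultimately show "0 \<in> free_tensors n \<and> f (tensor_class scale n 0) = g (tensor_class scale n 0)"
        using z[OF f] z[OF g] by (simp add: free_tensors_closed)
    next
      fix p q
      assume a: "p \<in> free_tensors n" "f (tensor_class scale n p) = g (tensor_class scale n p)"
        "q \<in> free_tensors n" "f (tensor_class scale n q) = g (tensor_class scale n q)"
      then show "p + q \<in> free_tensors n \<and>
          f (tensor_class scale n (p + q)) = g (tensor_class scale n (p + q))"
        using f g by (simp add: free_tensors_closed tensor_linear_def tensor_class_in_power
            flip: tensor_add_class)
    next
      fix c p
      assume a: "p \<in> free_tensors n" "f (tensor_class scale n p) = g (tensor_class scale n p)"
      then show "free_scale c p \<in> free_tensors n \<and>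
          f (tensor_class scale n (free_scale c p)) = g (tensor_class scale n (free_scale c p))"
        using f g by (simp add: free_tensors_closed tensor_linear_def tensor_class_in_power
            flip: tensor_scale_class)
    qed
    fix vs :: "'b list" assume "length vs = n"
    then show "Poly_Mapping.single vs 1 \<in> free_tensors n \<and>
        f (tensor_class scale n (Poly_Mapping.single vs 1)) =
        g (tensor_class scale n (Poly_Mapping.single vs 1))"
      using eq[of vs] by (simp add: pure_tensor_def single_in_free_tensors)
  qed
  then show ?thesis using p by simp
qed

lemma tensor_power_universal:
  fixes scale :: "'a::field \<Rightarrow> 'b::ab_group_add \<Rightarrow> 'b"
  assumes g: "\<And>vs. length vs = n \<Longrightarrow> g vs \<in> tensor_power scale m"
    and add: "\<And>us x y ws. length us + length ws + 1 = n \<Longrightarrow>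
      g (us @ (x + y) # ws) = tensor_add scale m (g (us @ x # ws)) (g (us @ y # ws))"
    and sc: "\<And>us c x ws. length us + length ws + 1 = n \<Longrightarrow>
      g (us @ scale c x # ws) = tensor_scale scale m c (g (us @ x # ws))"
  shows "\<exists>!f. f \<in> extensional (tensor_power scale n) \<and> tensor_linear scale n m f \<and>
      (\<forall>vs. length vs = n \<longrightarrow> f (pure_tensor scale vs) = g vs)"
proof (rule ex_ex1I)
  define r where "r vs = (SOME q. q \<in> free_tensors m \<and> g vs = tensor_class scale m q)" for vs
  have r: "r vs \<in> free_tensors m \<and> g vs = tensor_class scale m (r vs)" if vs: "length vs = n" for vs
  proof -
    obtain q where "q \<in> free_tensors m" "g vs = tensor_class scale m q"
      using g[OF vs] by (rule tensor_power_cases)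
    then have "\<exists>q. q \<in> free_tensors m \<and> g vs = tensor_class scale m q" by blast
    then show ?thesis unfolding r_def by (rule someI_ex)
  qed
  define G where "G = free_ext r"
  interpret G: Vector_Spaces.linear free_scale free_scale G
    unfolding G_def by (rule linear_free_ext)
  have Gs [simp]: "G (Poly_Mapping.single vs 1) = r vs" for vs by (simp add: G_def)
  have GF: "G p \<in> free_tensors m" if "p \<in> free_tensors n" for p
  proof (rule linear_image_span[OF G.linear_axioms subspace_free_tensors _
        that[unfolded free_tensors_eq_span]])
    fix q :: "'b list \<Rightarrow>\<^sub>0 'a"
    assume "q \<in> {Poly_Mapping.single xs (1::'a) | xs. length xs = n}"
    then obtain xs where "q = Poly_Mapping.single xs 1" "length xs = n" by blast
    then show "G q \<in> free_tensors m" using r[of xs] by simp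
  qed
  have GN: "G p \<in> null_tensors scale m" if "p \<in> null_tensors scale n" for p
  proof (rule linear_image_span[OF G.linear_axioms free.subspace_span _ that])
    fix q assume "q \<in> multilinear_relations scale n"
    then show "G q \<in> null_tensors scale m"
    proof (cases rule: multilinear_relations_cases)
      case (add us x y ws)
      have l: "length (us @ z # ws) = n" for z using add(1) by simp
      have "tensor_class scale m (r (us @ (x + y) # ws)) =
          tensor_class scale m (r (us @ x # ws) + r (us @ y # ws))"
        using assms(2)[OF add(1), of x y] r[OF l] by (simp add: tensor_add_class)
      then have "r (us @ (x + y) # ws) - (r (us @ x # ws) + r (us @ y # ws)) \<in> null_tensors scale m"
        using r[OF l] by (subst (asm) tensor_class_eq_iff) (auto intro: free_tensors_closed)
      then show ?thesis using add(2) by (simp add: G.diff G.add diff_diff_eq)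
    next
      case (scale us c x ws)
      have l: "length (us @ z # ws) = n" for z using scale(1) by simp
      have "tensor_class scale m (r (us @ scale c x # ws)) =
          tensor_class scale m (free_scale c (r (us @ x # ws)))"
        using sc[OF scale(1), of c x] r[OF l] by (simp add: tensor_scale_class)
      then have "r (us @ scale c x # ws) - free_scale c (r (us @ x # ws)) \<in> null_tensors scale m"
        using r[OF l] by (subst (asm) tensor_class_eq_iff) (auto intro: free_tensors_closed)
      then show ?thesis unfolding scale(2) G.diff G.scale by simp
    qed
  qed
  define f where "f = restrict (\<lambda>A. tensor_class scale m (G (SOME p. p \<in> A))) (tensor_power scale n)"
  have f: "f (tensor_class scale n p) = tensor_class scale m (G p)" if p: "p \<in> free_tensors n" for p
  proof -
    define q where "q = (SOME q. q \<in> tensor_class scale n p)"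
    have "q \<in> tensor_class scale n p"
      unfolding q_def using tensor_class_self[OF p] by (rule someI)
    then have q: "q \<in> free_tensors n" "p - q \<in> null_tensors scale n"
      using p by (auto simp: in_tensor_class)
    then have "tensor_class scale m (G p) = tensor_class scale m (G q)"
      using GN[OF q(2)] p GF by (simp add: tensor_class_eq_iff G.diff)
    then show ?thesis
      using p by (simp add: f_def tensor_class_in_power flip: q_def)
  qed
  have "tensor_linear scale n m f"
    unfolding tensor_linear_def
    by (auto elim!: tensor_power_cases simp: f tensor_class_in_power GF free_tensors_closed
        tensor_add_class tensor_scale_class G.add G.scale)
  moreover have "f (pure_tensor scale vs) = g vs" if "length vs = n" for vs
    using r[OF that] that by (simp add: pure_tensor_def f single_in_free_tensors)
  ultimately show "\<exists>f. f \<in> extensional (tensor_power scale n) \<and> tensor_linear scale n m f \<and>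
      (\<forall>vs. length vs = n \<longrightarrow> f (pure_tensor scale vs) = g vs)"
    by (intro exI[of _ f]) (simp add: f_def)
next
  fix f h
  assume f: "f \<in> extensional (tensor_power scale n) \<and> tensor_linear scale n m f \<and>
      (\<forall>vs. length vs = n \<longrightarrow> f (pure_tensor scale vs) = g vs)"
    and h: "h \<in> extensional (tensor_power scale n) \<and> tensor_linear scale n m h \<and>
      (\<forall>vs. length vs = n \<longrightarrow> h (pure_tensor scale vs) = g vs)"
  show "f = h"
  proof (rule extensionalityI[of f "tensor_power scale n" h])
    fix A assume "A \<in> tensor_power scale n"
    then show "f A = h A"
      by (rule tensor_linear_eqI[where m = m, rotated 3]) (use f h in simp_all)
  qed (use f h in simp_all)
qed

lemma tensor_linear_closed:
  "tensor_linear scale k l f \<Longrightarrow> A \<in> tensor_power scale k \<Longrightarrow> f A \<in> tensor_power scale l"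
  by (auto simp: tensor_linear_def)

lemma block_term_closed:
  assumes \<Psi>: "tensor_linear scale k l \<Psi>" and j: "j + k \<le> N" and vs: "length vs = N"
  shows "block_term scale k l \<Psi> j vs \<in> tensor_power scale (N - k + l)"
proof -
  have e: "N - k + l = (j + l) + (N - k - j)" using j by simp
  have "\<Psi> (pure_tensor scale (take k (drop j vs))) \<in> tensor_power scale l"
    using \<Psi> j vs by (intro tensor_linear_closed[OF \<Psi>] pure_tensor_closed) simp
  then show ?thesis
    unfolding block_term_def e vs using j vs
    by (intro tensor_mult_closed pure_tensor_closed) auto
qed

lemma block_term_multilinear:
  fixes scale :: "'a::field \<Rightarrow> 'b::ab_group_add \<Rightarrow> 'b"
  assumes \<Psi>: "tensor_linear scale k l \<Psi>" and j: "j + k \<le> N" and N: "length us + length ws + 1 = N"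
  shows "block_term scale k l \<Psi> j (us @ (x + y) # ws) =
      tensor_add scale (N - k + l)
        (block_term scale k l \<Psi> j (us @ x # ws)) (block_term scale k l \<Psi> j (us @ y # ws))" (is ?A)
    and "block_term scale k l \<Psi> j (us @ scale c x # ws) =
      tensor_scale scale (N - k + l) c (block_term scale k l \<Psi> j (us @ x # ws))" (is ?S)
proof -
  let ?i = "length us"
  have e: "N - k + l = (j + l) + (N - k - j)" using j by simp
  have len: "length (us @ z # ws) = N" for z using N by simp
  have PL: "pure_tensor scale (take j (us @ z # ws)) \<in> tensor_power scale j" for z
    using j N by (intro pure_tensor_closed) simp
  have PM: "pure_tensor scale (take k (drop j (us @ z # ws))) \<in> tensor_power scale k" for z
    using j N by (intro pure_tensor_closed) simp
  have PR: "pure_tensor scale (drop (j + k) (us @ z # ws)) \<in> tensor_power scale (N - k - j)" for z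
    using j N by (intro pure_tensor_closed) simp
  have P\<Psi>: "\<Psi> (pure_tensor scale (take k (drop j (us @ z # ws)))) \<in> tensor_power scale l" for z
    using \<Psi> PM by (auto simp: tensor_linear_def)
  note PLM = tensor_mult_closed[OF PL P\<Psi>]
  note cl = PL PM PR P\<Psi> PLM
  consider "?i < j" | "j \<le> ?i" "?i < j + k" | "j + k \<le> ?i" by linarith
  then have "?A \<and> ?S"
  proof cases
    case 1
    define ws' where "ws' = take (j - ?i - 1) ws"
    have L: "take j (us @ z # ws) = us @ z # ws'" for z
      using 1 by (cases "j - ?i") (auto simp: ws'_def)
    have M: "drop j (us @ z # ws) = drop j (us @ x # ws)"
      "drop (j + k) (us @ z # ws) = drop (j + k) (us @ x # ws)" for z
      using 1 by (auto simp: drop_Cons')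
    have lj: "length us + length ws' + 1 = j" using 1 j N by (simp add: ws'_def)
    show ?thesis
      using cl pure_tensor_add[of scale us x y ws'] pure_tensor_scale[of scale us c x ws'] lj
      unfolding block_term_def len e M[of "x + y"] M[of y] M[of "scale c x"] L
      by (simp add: tensor_mult_bilinear)
  next
    case 2
    define us' where "us' = drop j us"
    define ws' where "ws' = take (j + k - ?i - 1) ws"
    have L: "take j (us @ z # ws) = take j (us @ x # ws)"
      "drop (j + k) (us @ z # ws) = drop (j + k) (us @ x # ws)" for z
      using 2 by (auto simp: drop_Cons')
    have "take (k - (?i - j)) (z # ws) = z # ws'" for z
      using 2 by (cases "k - (?i - j)") (auto simp: ws'_def intro!: arg_cong2[of _ _ _ _ take])
    then have M: "take k (drop j (us @ z # ws)) = us' @ z # ws'" for z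
      using 2 by (simp add: us'_def)
    have lk: "length us' + length ws' + 1 = k" using 2 j N by (simp add: us'_def ws'_def)
    show ?thesis
      using cl \<Psi> pure_tensor_add[of scale us' x y ws'] pure_tensor_scale[of scale us' c x ws'] lk
      unfolding block_term_def len e L[of "x + y"] L[of y] L[of "scale c x"] M tensor_linear_def
      by (simp add: tensor_mult_bilinear)
  next
    case 3
    define us' where "us' = drop (j + k) us"
    have L: "take j (us @ z # ws) = take j (us @ x # ws)"
      "take k (drop j (us @ z # ws)) = take k (drop j (us @ x # ws))" for z
      using 3 by auto
    have M: "drop (j + k) (us @ z # ws) = us' @ z # ws" for z
      using 3 by (simp add: us'_def)
    have lk: "length us' + length ws + 1 = N - k - j" using 3 j N by (simp add: us'_def)
    show ?thesis
      using cl pure_tensor_add[of scale us' x y ws] pure_tensor_scale[of scale us' c x ws] lk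
      unfolding block_term_def len e L[of "x + y"] L[of y] L[of "scale c x"] M
      by (simp add: tensor_mult_bilinear)
  qed
  then show ?A ?S by auto
qed

lemma tensor_sum_cong:
  "(\<And>j. j < m \<Longrightarrow> f j = g j) \<Longrightarrow> tensor_sum scale n f m = tensor_sum scale n g m"
  by (induction m) auto

theorem insertion_ex1:
  fixes scale :: "'a::field \<Rightarrow> 'b::ab_group_add \<Rightarrow> 'b"
  assumes \<Psi>: "tensor_linear scale k l \<Psi>" and "k \<le> N"
  shows "\<exists>!f. f \<in> extensional (tensor_power scale N) \<and> tensor_linear scale N (N - k + l) f \<and>
      (\<forall>vs. length vs = N \<longrightarrow>
         f (pure_tensor scale vs) =
           tensor_sum scale (N - k + l) (\<lambda>j. block_term scale k l \<Psi> j vs) (N - k + 1))"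
proof (rule tensor_power_universal)
  have j: "j + k \<le> N" if "j < N - k + 1" for j using that \<open>k \<le> N\<close> by simp
  note cl = block_term_closed[OF \<Psi> j]
  show "tensor_sum scale (N - k + l) (\<lambda>j. block_term scale k l \<Psi> j vs) (N - k + 1)
      \<in> tensor_power scale (N - k + l)" if "length vs = N" for vs
    using that by (intro tensor_sum_closed cl)
  fix us ws :: "'b list" and x y :: 'b and c
  assume N: "length us + length ws + 1 = N"
  have len: "length (us @ z # ws) = N" for z using N by simp
  show "tensor_sum scale (N - k + l) (\<lambda>j. block_term scale k l \<Psi> j (us @ (x + y) # ws)) (N - k + 1) =
      tensor_add scale (N - k + l)
        (tensor_sum scale (N - k + l) (\<lambda>j. block_term scale k l \<Psi> j (us @ x # ws)) (N - k + 1))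
        (tensor_sum scale (N - k + l) (\<lambda>j. block_term scale k l \<Psi> j (us @ y # ws)) (N - k + 1))"
    by (subst tensor_sum_add[symmetric])
      (auto intro!: tensor_sum_cong cl[OF _ len] simp del: tensor_sum.simps
        simp: block_term_multilinear[OF \<Psi> j N])
  show "tensor_sum scale (N - k + l) (\<lambda>j. block_term scale k l \<Psi> j (us @ scale c x # ws)) (N - k + 1) =
      tensor_scale scale (N - k + l) c
        (tensor_sum scale (N - k + l) (\<lambda>j. block_term scale k l \<Psi> j (us @ x # ws)) (N - k + 1))"
    by (subst tensor_sum_scale[symmetric])
      (auto intro!: tensor_sum_cong cl[OF _ len] simp del: tensor_sum.simps
        simp: block_term_multilinear[OF \<Psi> j N])
qed

lemma insertion:
  assumes "tensor_linear scale k l \<Psi>" "k \<le> N"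
  shows "insertion scale k l \<Psi> N \<in> extensional (tensor_power scale N)"
    and "tensor_linear scale N (N - k + l) (insertion scale k l \<Psi> N)"
    and "length vs = N \<Longrightarrow> insertion scale k l \<Psi> N (pure_tensor scale vs) =
      tensor_sum scale (N - k + l) (\<lambda>j. block_term scale k l \<Psi> j vs) (N - k + 1)"
  using theI'[OF insertion_ex1[OF assms], folded insertion_def] by auto

end

theory Submission
  imports Defs
begin

text \<open>
  Expand \<open>i(\<Psi>\<^sub>1) \<circ> i(\<Psi>\<^sub>2)\<close> as a sum over pairs of positions \<open>(i, j)\<close>, where \<open>\<Psi>\<^sub>2\<close> is applied at \<open>j\<close>
  and then \<open>\<Psi>\<^sub>1\<close> at \<open>i\<close>. If the input block of \<open>\<Psi>\<^sub>1\<close> lies to the left or to the right of the output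
  block of \<open>\<Psi>\<^sub>2\<close>, the two applications commute and the term also occurs in \<open>i(\<Psi>\<^sub>2) \<circ> i(\<Psi>\<^sub>1)\<close>. The
  remaining terms depend only on \<open>i - j\<close> up to translation; if the two blocks share \<open>s\<close> factors, the
  translates of such a term make up \<open>i\<close> of a map from degree \<open>k\<^sub>1 + k\<^sub>2 - s\<close> to degree
  \<open>l\<^sub>1 + l\<^sub>2 - s\<close>. All of this is an identity between linear maps of the free vector spaces on lists,
  after lifting \<open>\<Psi>\<^sub>1\<close> and \<open>\<Psi>\<^sub>2\<close> to them.
\<close>

section \<open>Linear maps of free vector spaces\<close>

abbreviation free_linear :: "(('c \<Rightarrow>\<^sub>0 'a::field) \<Rightarrow> ('d \<Rightarrow>\<^sub>0 'a)) \<Rightarrow> bool" where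
  "free_linear \<equiv> Vector_Spaces.linear free_scale free_scale"

lemma free_linearI:
  assumes "\<And>p q. f (p + q) = f p + f q" "\<And>c p. f (free_scale c p) = free_scale c (f p)"
  shows "free_linear f"
  by unfold_locales (use assms in auto)

lemma free_linear_simps:
  assumes "free_linear f"
  shows "f (p + q) = f p + f q" "f (free_scale c p) = free_scale c (f p)" "f (p - q) = f p - f q"
    "f 0 = 0" "f (sum h S) = (\<Sum>x\<in>S. f (h x))"
proof -
  interpret f: Vector_Spaces.linear free_scale free_scale f by fact
  show "f (p + q) = f p + f q" "f (free_scale c p) = free_scale c (f p)" "f (p - q) = f p - f q"
    "f 0 = 0" "f (sum h S) = (\<Sum>x\<in>S. f (h x))"
    by (simp_all add: f.add f.scale f.diff f.zero f.sum)
qed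

lemmas free_mult_linear_simps =
  free_linear_simps[OF linear_free_mult_left] free_linear_simps[OF linear_free_mult_right]

lemma free_linear_comp:
  assumes "free_linear f" "free_linear g"
  shows "free_linear (\<lambda>p. f (g p))"
  using Vector_Spaces.linear_compose[OF assms(2,1)] by (simp add: comp_def)

lemma free_linear_diff:
  assumes f: "free_linear f" and g: "free_linear g"
  shows "free_linear (\<lambda>p. f p - g p)"
  by (rule free_linearI)
    (simp_all add: free_linear_simps[OF f] free_linear_simps[OF g] free.scale_right_diff_distrib)

lemma free_linear_scale:
  assumes f: "free_linear f"
  shows "free_linear (\<lambda>p. free_scale c (f p))"
  by (rule free_linearI)
    (simp_all add: free_linear_simps[OF f] free.scale_right_distrib mult.commute)

lemma free_linear_sum:
  assumes f: "\<And>x. x \<in> S \<Longrightarrow> free_linear (f x)"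
  shows "free_linear (\<lambda>p. \<Sum>x\<in>S. f x p)"
  by (rule free_linearI)
    (simp_all add: free_linear_simps(1,2)[OF f] sum.distrib free.scale_sum_right)

text \<open>Agreement is demanded on the support of \<open>p\<close> only, so that
  \<open>free_linear_eq_on_tensors\<close> can compare two maps in a single degree.\<close>

lemma free_linear_eqI:
  assumes f: "free_linear f" and g: "free_linear g"
    and eq: "\<And>x. x \<in> Poly_Mapping.keys p \<Longrightarrow>
      f (Poly_Mapping.single x 1) = g (Poly_Mapping.single x 1)"
  shows "f p = g p"
proof -
  let ?q = "\<Sum>x\<in>Poly_Mapping.keys p.
    free_scale (Poly_Mapping.lookup p x) (Poly_Mapping.single x 1)"
  have "f ?q = g ?q"
    unfolding free_linear_simps(5)[OF f] free_linear_simps(5)[OF g]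
    by (intro sum.cong refl) (simp only: free_linear_simps(2)[OF f] free_linear_simps(2)[OF g] eq)
  then show ?thesis by (simp add: poly_mapping_sum_singles)
qed

lemma free_linear_eq_on_tensors:
  assumes "free_linear f" "free_linear g" "p \<in> free_tensors n"
    and "\<And>xs. length xs = n \<Longrightarrow> f (Poly_Mapping.single xs 1) = g (Poly_Mapping.single xs 1)"
  shows "f p = g p"
proof (rule free_linear_eqI[OF assms(1,2)])
  fix xs assume "xs \<in> Poly_Mapping.keys p"
  with assms(3) have "length xs = n" by (auto simp: free_tensors_def)
  then show "f (Poly_Mapping.single xs 1) = g (Poly_Mapping.single xs 1)" by (rule assms(4))
qed

text \<open>Both sides are linear in each argument; reducing one argument after the other to basis
  lists leaves associativity of append.\<close>

lemma free_mult_assoc: "free_mult (free_mult p q) r = free_mult p (free_mult q r)"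
proof -
  note lin = linear_free_mult_left linear_free_mult_right
    free_linear_comp[OF linear_free_mult_left] free_linear_comp[OF linear_free_mult_right]
  show ?thesis
  proof (rule free_linear_eqI[where p = p], goal_cases)
    case (3 xs)
    show ?case
    proof (rule free_linear_eqI[where p = q], goal_cases)
      case (3 ys)
      show ?case
        by (rule free_linear_eqI[where p = r]) (simp_all add: lin)
    qed (simp_all add: lin)
  qed (simp_all add: lin)
qed

lemma free_mult_Nil [simp]:
  "free_mult (Poly_Mapping.single [] 1) p = p" "free_mult p (Poly_Mapping.single [] 1) = p"
proof -
  have id: "free_linear (\<lambda>p. p)" by (rule free_linearI) simp_all
  show "free_mult (Poly_Mapping.single [] 1) p = p" "free_mult p (Poly_Mapping.single [] 1) = p"
    by (rule free_linear_eqI[OF _ id], simp_all add: linear_free_mult_left linear_free_mult_right)+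
qed

section \<open>Applying a map to one block\<close>

text \<open>The free counterpart of \<open>block_term\<close>: id \<otimes> G \<otimes> id with
  \<open>j\<close> factors on the left. It has this meaning on lists of length at least
  \<open>j + k\<close>; extending from basis lists makes it linear for every
  \<open>G\<close>.\<close>

definition block_map ::
    "nat \<Rightarrow> nat \<Rightarrow> (('b list \<Rightarrow>\<^sub>0 'a::field) \<Rightarrow> ('b list \<Rightarrow>\<^sub>0 'a)) \<Rightarrow>
       ('b list \<Rightarrow>\<^sub>0 'a) \<Rightarrow> ('b list \<Rightarrow>\<^sub>0 'a)" where
  "block_map j k G = free_ext (\<lambda>xs.
     free_mult (free_mult (Poly_Mapping.single (take j xs) 1)
         (G (Poly_Mapping.single (take k (drop j xs)) 1)))
       (Poly_Mapping.single (drop (j + k) xs) 1))"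

lemma block_map_single:
  "block_map j k G (Poly_Mapping.single xs 1) =
     free_mult (free_mult (Poly_Mapping.single (take j xs) 1)
         (G (Poly_Mapping.single (take k (drop j xs)) 1)))
       (Poly_Mapping.single (drop (j + k) xs) 1)"
  by (simp add: block_map_def)

lemma free_linear_block_map: "free_linear (block_map j k G)"
  unfolding block_map_def by (rule linear_free_ext)

lemma block_map_scaled_sum:
  "block_map j k (\<lambda>p. \<Sum>x\<in>S. free_scale (c x) (H x p)) p =
     (\<Sum>x\<in>S. free_scale (c x) (block_map j k (H x) p))"
  by (rule free_linear_eqI[where p = p])
    (auto intro!: free_linear_block_map free_linear_sum free_linear_scale
      simp: block_map_single free_mult_linear_simps)

lemma block_map_diff:
  "block_map j k (\<lambda>p. G p - H p) p = block_map j k G p - block_map j k H p"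
  by (rule free_linear_eqI[where p = p])
    (auto intro!: free_linear_block_map free_linear_diff
      simp: block_map_single free_mult_linear_simps)

text \<open>On basis lists a block inside the middle factor stays clear of both outer factors, which
  are carried along; only its position moves, by the degree \<open>m\<close> of the left
  one.\<close>

lemma block_map_shift:
  fixes u x v :: "'b list \<Rightarrow>\<^sub>0 'a::field"
  assumes d: "d + k \<le> K" and u: "u \<in> free_tensors m" and x: "x \<in> free_tensors K"
  shows "block_map (m + d) k G (free_mult (free_mult u x) v) =
           free_mult (free_mult u (block_map d k G x)) v"
proof -
  note lin = linear_free_mult_left linear_free_mult_right free_linear_block_map
  note comp = lin lin[THEN free_linear_comp]
  show ?thesis
  proof (rule free_linear_eq_on_tensors[OF _ _ u], goal_cases)
    case 1 show ?case by (intro comp)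
  next
    case 2 show ?case by (intro comp)
  next
    case (3 us)
    show ?case
    proof (rule free_linear_eq_on_tensors[OF _ _ x], goal_cases)
      case 1 show ?case by (intro comp)
    next
      case 2 show ?case by (intro comp)
    next
      case (3 xs)
      show ?case
      proof (rule free_linear_eqI[where p = v], goal_cases)
        case 1 show ?case by (intro comp)
      next
        case 2 show ?case by (intro comp)
      next
        case (3 vs)
        have e: "take (m + d) (us @ xs @ vs) = us @ take d xs"
          "take k (drop (m + d) (us @ xs @ vs)) = take k (drop d xs)"
          "drop (m + d + k) (us @ xs @ vs) = drop (d + k) xs @ vs"
          using \<open>length us = m\<close> \<open>length xs = K\<close> d by auto
        show ?case
          unfolding free_mult_single append_assoc block_map_single e
          by (simp add: free_mult_assoc flip: free_mult_single)
      qed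
    qed
  qed
qed

lemma block_map_closed:
  fixes p :: "'b list \<Rightarrow>\<^sub>0 'a::field"
  assumes G: "\<And>q. q \<in> free_tensors k \<Longrightarrow> G q \<in> free_tensors l" and j: "j + k \<le> N"
    and p: "p \<in> free_tensors N"
  shows "block_map j k G p \<in> free_tensors (N - k + l)"
  using p
proof (rule free_tensors_induct)
  show "free.subspace {p. block_map j k G p \<in> free_tensors (N - k + l)}"
    by (auto simp: free.subspace_def free_linear_simps[OF free_linear_block_map]
        intro: free_tensors_closed)
  fix xs :: "'b list" assume xs: "length xs = N"
  have "free_mult (free_mult (Poly_Mapping.single (take j xs) 1)
         (G (Poly_Mapping.single (take k (drop j xs)) 1)))
       (Poly_Mapping.single (drop (j + k) xs) 1) \<in> free_tensors ((j + l) + (N - k - j))"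
    using xs j by (intro free_mult_closed G single_in_free_tensors) auto
  then show "block_map j k G (Poly_Mapping.single xs 1) \<in> free_tensors (N - k + l)"
    using j by (simp add: block_map_single add.commute)
qed

text \<open>The list is cut at the ends of a window of \<open>K\<close> factors starting at
  \<open>m\<close>, and \<open>block_map_shift\<close> is applied to each map. This turns the
  translates of one overlapping pair into the block terms of a single map of degree
  \<open>K\<close>.\<close>

lemma block_map_nested:
  fixes p :: "'b list \<Rightarrow>\<^sub>0 'a::field"
  assumes c2: "\<And>q. q \<in> free_tensors k2 \<Longrightarrow> G2 q \<in> free_tensors l2"
    and d2: "d2 + k2 \<le> K" and d1: "d1 + k1 \<le> K - k2 + l2" and m: "m + K \<le> N"
    and p: "p \<in> free_tensors N"
  shows "block_map m K (\<lambda>q. block_map d1 k1 G1 (block_map d2 k2 G2 q)) p =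
           block_map (m + d1) k1 G1 (block_map (m + d2) k2 G2 p)"
proof (rule free_linear_eq_on_tensors[OF free_linear_block_map _ p])
  show "free_linear (\<lambda>p. block_map (m + d1) k1 G1 (block_map (m + d2) k2 G2 p))"
    by (rule free_linear_comp[OF free_linear_block_map free_linear_block_map])
  fix xs :: "'b list" assume xs: "length xs = N"
  define u x v where uxv: "u = Poly_Mapping.single (take m xs) (1::'a)"
    "x = Poly_Mapping.single (take K (drop m xs)) (1::'a)"
    "v = Poly_Mapping.single (drop (m + K) xs) (1::'a)"
  have "take m xs @ take K (drop m xs) @ drop (m + K) xs = xs"
    by (metis append_take_drop_id drop_drop add.commute)
  then have eq: "Poly_Mapping.single xs 1 = free_mult (free_mult u x) v"
    by (simp add: uxv)
  have u: "u \<in> free_tensors m" and x: "x \<in> free_tensors K"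
    using m xs by (auto simp: uxv intro!: single_in_free_tensors)
  have "block_map m K (\<lambda>q. block_map d1 k1 G1 (block_map d2 k2 G2 q)) (Poly_Mapping.single xs 1) =
      free_mult (free_mult u (block_map d1 k1 G1 (block_map d2 k2 G2 x))) v"
    by (simp add: block_map_single uxv)
  also have "\<dots> = block_map (m + d1) k1 G1 (block_map (m + d2) k2 G2 (free_mult (free_mult u x) v))"
    using block_map_closed[OF c2 d2 x]
    by (simp add: block_map_shift[OF d2 u x] block_map_shift[OF d1 u])
  finally show "block_map m K (\<lambda>q. block_map d1 k1 G1 (block_map d2 k2 G2 q)) (Poly_Mapping.single xs 1) =
      block_map (m + d1) k1 G1 (block_map (m + d2) k2 G2 (Poly_Mapping.single xs 1))"
    by (simp only: eq)
qed

text \<open>Cutting the list at \<open>j\<close> puts the two blocks into different tensor factors.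
  The position \<open>j\<close> becomes \<open>j - k1 + l1\<close> because \<open>G1\<close> changes
  the degree of the left factor.\<close>

lemma block_map_commute:
  fixes p :: "'b list \<Rightarrow>\<^sub>0 'a::field"
  assumes c1: "\<And>q. q \<in> free_tensors k1 \<Longrightarrow> G1 q \<in> free_tensors l1"
    and i: "i + k1 \<le> j" and j: "j + k2 \<le> N" and p: "p \<in> free_tensors N"
  shows "block_map i k1 G1 (block_map j k2 G2 p) =
           block_map (j - k1 + l1) k2 G2 (block_map i k1 G1 p)"
proof (rule free_linear_eq_on_tensors[OF _ _ p])
  show "free_linear (\<lambda>p. block_map i k1 G1 (block_map j k2 G2 p))"
    "free_linear (\<lambda>p. block_map (j - k1 + l1) k2 G2 (block_map i k1 G1 p))"
    by (rule free_linear_comp[OF free_linear_block_map free_linear_block_map])+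
  fix xs :: "'b list" assume xs: "length xs = N"
  define y z where yz: "y = Poly_Mapping.single (take j xs) (1::'a)"
    "z = Poly_Mapping.single (drop j xs) (1::'a)"
  have eq: "Poly_Mapping.single xs 1 = free_mult y z"
    by (simp add: yz)
  have y: "y \<in> free_tensors j" and z: "z \<in> free_tensors (N - j)"
    using j xs by (auto simp: yz intro!: single_in_free_tensors)
  \<comment> \<open>\<open>left\<close> and \<open>right\<close> are \<open>block_map_shift\<close>
    with the empty list as left and as right outer factor; \<open>right\<close> is used before and
    after \<open>G1\<close> has acted on \<open>y\<close>.\<close>
  have left: "block_map i k1 G1 (free_mult y q) = free_mult (block_map i k1 G1 y) q" for q
    using block_map_shift[OF i single_in_free_tensors[of "[]" 0 1] y, where v = q] by simp
  have k2: "0 + k2 \<le> N - j" using j by simp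
  have right: "block_map n k2 G2 (free_mult q z) = free_mult q (block_map 0 k2 G2 z)"
    if "q \<in> free_tensors n" for q n
    using block_map_shift[OF k2 that z, where v = "Poly_Mapping.single [] 1"] by simp
  show "block_map i k1 G1 (block_map j k2 G2 (Poly_Mapping.single xs 1)) =
      block_map (j - k1 + l1) k2 G2 (block_map i k1 G1 (Poly_Mapping.single xs 1))"
    using right[OF block_map_closed[where G = G1, OF c1 i y]] by (simp only: eq left right[OF y])
qed

section \<open>Lifting linear maps of tensor powers\<close>

text \<open>What a map of representatives needs in order to descend to the quotients.\<close>

definition tensor_lift ::
    "('a::field \<Rightarrow> 'b::ab_group_add \<Rightarrow> 'b) \<Rightarrow> nat \<Rightarrow> nat \<Rightarrow>
       (('b list \<Rightarrow>\<^sub>0 'a) \<Rightarrow> ('b list \<Rightarrow>\<^sub>0 'a)) \<Rightarrow> bool" where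
  "tensor_lift scale k l G \<longleftrightarrow> free_linear G \<and>
     (\<forall>p\<in>free_tensors k. G p \<in> free_tensors l) \<and>
     (\<forall>p\<in>null_tensors scale k. G p \<in> null_tensors scale l)"

definition induced_map ::
    "('a::field \<Rightarrow> 'b::ab_group_add \<Rightarrow> 'b) \<Rightarrow> nat \<Rightarrow>
       (('b list \<Rightarrow>\<^sub>0 'a) \<Rightarrow> ('b list \<Rightarrow>\<^sub>0 'a)) \<Rightarrow>
       ('b list \<Rightarrow>\<^sub>0 'a) set \<Rightarrow> ('b list \<Rightarrow>\<^sub>0 'a) set" where
  "induced_map scale l G A = tensor_class scale l (G (SOME p. p \<in> A))"

lemma induced_map_class:
  assumes G: "tensor_lift scale k l G" and p: "p \<in> free_tensors k"
  shows "induced_map scale l G (tensor_class scale k p) = tensor_class scale l (G p)"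
proof -
  define q where "q = (SOME q. q \<in> tensor_class scale k p)"
  have lin: "free_linear G" using G by (simp add: tensor_lift_def)
  have "q \<in> tensor_class scale k p"
    unfolding q_def using tensor_class_self[OF p] by (rule someI)
  then have q: "q \<in> free_tensors k" "p - q \<in> null_tensors scale k"
    using p by (auto simp: in_tensor_class)
  then have "G p - G q \<in> null_tensors scale l"
    using G by (auto simp: tensor_lift_def simp flip: free_linear_simps(3)[OF lin])
  then have "tensor_class scale l (G p) = tensor_class scale l (G q)"
    using G p q by (subst tensor_class_eq_iff) (auto simp: tensor_lift_def)
  then show ?thesis by (simp add: induced_map_def flip: q_def)
qed

lemma tensor_linear_induced_map:
  assumes G: "tensor_lift scale k l G"
  shows "tensor_linear scale k l (induced_map scale l G)"
proof -
  have lin: "free_linear G" and cl: "\<And>p. p \<in> free_tensors k \<Longrightarrow> G p \<in> free_tensors l"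
    using G by (auto simp: tensor_lift_def)
  show ?thesis
    unfolding tensor_linear_def
    by (auto elim!: tensor_power_cases simp: induced_map_class[OF G] tensor_class_in_power cl
        free_tensors_closed tensor_add_class tensor_scale_class free_linear_simps[OF lin])
qed

text \<open>The tensors on which \<open>f\<close> is computed by \<open>H\<close> form a subspace,
  so agreement on pure tensors suffices.\<close>

lemma tensor_linear_class_eq:
  fixes scale :: "'a::field \<Rightarrow> 'b::ab_group_add \<Rightarrow> 'b"
  assumes f: "tensor_linear scale n m f" and H: "free_linear H"
    and cl: "\<And>p. p \<in> free_tensors n \<Longrightarrow> H p \<in> free_tensors m"
    and eq: "\<And>xs. length xs = n \<Longrightarrow>
      f (pure_tensor scale xs) = tensor_class scale m (H (Poly_Mapping.single xs 1))"
    and p: "p \<in> free_tensors n"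
  shows "f (tensor_class scale n p) = tensor_class scale m (H p)"
proof -
  have add: "f (tensor_class scale n (p + q)) =
      tensor_add scale m (f (tensor_class scale n p)) (f (tensor_class scale n q))"
    if "p \<in> free_tensors n" "q \<in> free_tensors n" for p q
    using f that by (simp add: tensor_linear_def tensor_class_in_power flip: tensor_add_class)
  have scale: "f (tensor_class scale n (free_scale c p)) = tensor_scale scale m c (f (tensor_class scale n p))"
    if "p \<in> free_tensors n" for c p
    using f that by (simp add: tensor_linear_def tensor_class_in_power flip: tensor_scale_class)
  \<comment> \<open>\<open>tensor_linear\<close> speaks of sums and scalar multiples only; the value
    at the zero class is obtained by scaling with 0.\<close>
  have zero: "f (tensor_class scale n 0) = tensor_class scale m 0"
  proof -
    have "f (tensor_class scale n 0) \<in> tensor_power scale m"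
      by (intro tensor_linear_closed[OF f] tensor_class_in_power free_tensors_closed)
    then obtain q where "q \<in> free_tensors m" "f (tensor_class scale n 0) = tensor_class scale m q"
      by (rule tensor_power_cases)
    then show ?thesis
      using scale[of 0 0] by (simp add: free_tensors_closed tensor_scale_class)
  qed
  have "p \<in> free_tensors n \<and> f (tensor_class scale n p) = tensor_class scale m (H p)"
    using p
  proof (rule free_tensors_induct)
    show "free.subspace {p. p \<in> free_tensors n \<and> f (tensor_class scale n p) = tensor_class scale m (H p)}"
      by (auto simp: free.subspace_def free_tensors_closed zero add scale free_linear_simps[OF H]
          tensor_add_class tensor_scale_class cl)
  qed (use eq in \<open>auto simp: single_in_free_tensors pure_tensor_def\<close>)
  then show ?thesis by simp
qed

text \<open>A null tensor has the class of 0, and \<open>f\<close> acts on classes, so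
  \<open>H\<close> must send it into the class of 0.\<close>

lemma tensor_liftI:
  fixes scale :: "'a::field \<Rightarrow> 'b::ab_group_add \<Rightarrow> 'b"
  assumes f: "tensor_linear scale n m f" and H: "free_linear H"
    and cl: "\<And>p. p \<in> free_tensors n \<Longrightarrow> H p \<in> free_tensors m"
    and eq: "\<And>xs. length xs = n \<Longrightarrow>
      f (pure_tensor scale xs) = tensor_class scale m (H (Poly_Mapping.single xs 1))"
  shows "tensor_lift scale n m H"
  unfolding tensor_lift_def
proof (intro conjI ballI)
  fix p assume p: "p \<in> null_tensors scale n"
  then have pF: "p \<in> free_tensors n" using null_tensors_subset by blast
  have "tensor_class scale n p = tensor_class scale n 0"
    using p pF by (simp add: tensor_class_eq_iff free_tensors_closed)
  then have "tensor_class scale m (H p) = tensor_class scale m (H 0)"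
    using tensor_linear_class_eq[OF f H cl eq pF] tensor_linear_class_eq[OF f H cl eq, of 0]
    by (simp add: free_tensors_closed)
  then show "H p \<in> null_tensors scale m"
    using cl[OF pF] by (simp add: free_linear_simps[OF H] tensor_class_eq_iff free_tensors_closed)
qed (use H cl in auto)

text \<open>Representatives of the values on pure tensors are chosen list by list and extended
  linearly over the free space.\<close>

lemma tensor_lift_exists:
  fixes scale :: "'a::field \<Rightarrow> 'b::ab_group_add \<Rightarrow> 'b"
  assumes \<Psi>: "tensor_linear scale k l \<Psi>"
  obtains G where "tensor_lift scale k l G"
    "\<And>p. p \<in> free_tensors k \<Longrightarrow> \<Psi> (tensor_class scale k p) = tensor_class scale l (G p)"
proof -
  have "\<exists>q. length xs = k \<longrightarrow> q \<in> free_tensors l \<and> \<Psi> (pure_tensor scale xs) = tensor_class scale l q" for xs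
    using tensor_linear_closed[OF \<Psi> pure_tensor_closed[of xs k scale]] by (metis tensor_power_cases)
  then obtain r where r: "\<And>xs. length xs = k \<Longrightarrow>
      r xs \<in> free_tensors l \<and> \<Psi> (pure_tensor scale xs) = tensor_class scale l (r xs)"
    by metis
  have cl: "free_ext r p \<in> free_tensors l" if "p \<in> free_tensors k" for p
    unfolding free_ext_def using that r
    by (intro free.subspace_sum subspace_free_tensors free_tensors_closed) (auto simp: free_tensors_def)
  have eq: "\<Psi> (pure_tensor scale xs) = tensor_class scale l (free_ext r (Poly_Mapping.single xs 1))"
    if "length xs = k" for xs using r[OF that] by simp
  show thesis
    using tensor_liftI[OF \<Psi> linear_free_ext cl eq] tensor_linear_class_eq[OF \<Psi> linear_free_ext cl eq]
    by (rule that)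
qed

lemma block_term_eq_class:
  assumes cl: "\<And>q. q \<in> free_tensors k \<Longrightarrow> G q \<in> free_tensors l"
    and eq: "\<And>p. p \<in> free_tensors k \<Longrightarrow> \<Psi> (tensor_class scale k p) = tensor_class scale l (G p)"
    and j: "j + k \<le> length vs"
  shows "block_term scale k l \<Psi> j vs =
    tensor_class scale (length vs - k + l) (block_map j k G (Poly_Mapping.single vs 1))"
proof -
  have e: "length vs - k + l = (j + l) + (length vs - k - j)" using j by simp
  have l: "length (take j vs) = j" "length (take k (drop j vs)) = k"
    "length (drop (j + k) vs) = length vs - k - j" using j by auto
  have F: "Poly_Mapping.single (take j vs) 1 \<in> free_tensors j"
    "Poly_Mapping.single (take k (drop j vs)) 1 \<in> free_tensors k"
    "Poly_Mapping.single (drop (j + k) vs) 1 \<in> free_tensors (length vs - k - j)"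
    using l by (auto intro!: single_in_free_tensors)
  show ?thesis
    unfolding block_term_def block_map_single e pure_tensor_def l
    by (simp add: eq F cl tensor_mult_class free_mult_closed del: diff_diff_left)
qed

text \<open>Preservation of null tensors is not checked on relations: multilinearity of
  \<open>block_term\<close> and the universal property give a linear map of tensor powers, of which
  \<open>block_map j k G\<close> is a lift by \<open>tensor_liftI\<close>.\<close>

lemma tensor_lift_block_map:
  fixes scale :: "'a::field \<Rightarrow> 'b::ab_group_add \<Rightarrow> 'b"
  assumes G: "tensor_lift scale k l G" and j: "j + k \<le> N"
  shows "tensor_lift scale N (N - k + l) (block_map j k G)"
proof -
  let ?\<Psi> = "induced_map scale l G"
  have cl: "\<And>q. q \<in> free_tensors k \<Longrightarrow> G q \<in> free_tensors l"
    using G by (simp add: tensor_lift_def)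
  note \<Psi> = tensor_linear_induced_map[OF G]
  have "\<exists>!f. f \<in> extensional (tensor_power scale N) \<and> tensor_linear scale N (N - k + l) f \<and>
      (\<forall>vs. length vs = N \<longrightarrow> f (pure_tensor scale vs) = block_term scale k l ?\<Psi> j vs)"
    by (intro tensor_power_universal block_term_closed[OF \<Psi> j] block_term_multilinear[OF \<Psi> j])
  then obtain f where f: "tensor_linear scale N (N - k + l) f"
    "\<And>vs. length vs = N \<Longrightarrow> f (pure_tensor scale vs) = block_term scale k l ?\<Psi> j vs"
    by blast
  show ?thesis
  proof (rule tensor_liftI[OF f(1) free_linear_block_map block_map_closed[OF cl j]])
    fix xs :: "'b list" assume xs: "length xs = N"
    show "f (pure_tensor scale xs) =
        tensor_class scale (N - k + l) (block_map j k G (Poly_Mapping.single xs 1))"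
      using block_term_eq_class[where G = G and \<Psi> = ?\<Psi>, OF cl induced_map_class[OF G], of j xs] f(2)[OF xs] j xs by simp
  qed
qed

text \<open>The bridge to free vector spaces: on representatives, the insertion becomes a plain sum
  of block maps of a lift.\<close>

lemma insertion_class:
  fixes scale :: "'a::field \<Rightarrow> 'b::ab_group_add \<Rightarrow> 'b"
  assumes \<Psi>: "tensor_linear scale k l \<Psi>" and k: "k \<le> N"
    and cl: "\<And>q. q \<in> free_tensors k \<Longrightarrow> G q \<in> free_tensors l"
    and eq: "\<And>p. p \<in> free_tensors k \<Longrightarrow> \<Psi> (tensor_class scale k p) = tensor_class scale l (G p)"
    and p: "p \<in> free_tensors N"
  shows "insertion scale k l \<Psi> N (tensor_class scale N p) =
    tensor_class scale (N - k + l) (\<Sum>j<N - k + 1. block_map j k G p)"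
proof (rule tensor_linear_class_eq[OF insertion(2)[OF \<Psi> k] _ _ _ p])
  show "free_linear (\<lambda>p. \<Sum>j<N - k + 1. block_map j k G p)"
    by (intro free_linear_sum free_linear_block_map)
  have j: "j + k \<le> N" if "j < N - k + 1" for j using that k by simp
  have cl': "block_map j k G p \<in> free_tensors (N - k + l)"
    if "j < N - k + 1" "p \<in> free_tensors N" for j p
    by (rule block_map_closed[OF cl j[OF that(1)] that(2)])
  show "(\<Sum>j<N - k + 1. block_map j k G p) \<in> free_tensors (N - k + l)"
    if "p \<in> free_tensors N" for p
    using cl' that by (intro free.subspace_sum subspace_free_tensors) simp
  fix xs :: "'b list" assume xs: "length xs = N"
  show "insertion scale k l \<Psi> N (pure_tensor scale xs) =
      tensor_class scale (N - k + l) (\<Sum>j<N - k + 1. block_map j k G (Poly_Mapping.single xs 1))"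
    unfolding insertion(3)[OF \<Psi> k xs]
  proof (intro tensor_sum_class conjI)
    fix n assume n: "n < N - k + 1"
    show "block_map n k G (Poly_Mapping.single xs 1) \<in> free_tensors (N - k + l)"
      using xs by (intro cl'[OF n] single_in_free_tensors)
    show "block_term scale k l \<Psi> n xs =
        tensor_class scale (N - k + l) (block_map n k G (Poly_Mapping.single xs 1))"
      using block_term_eq_class[where G = G and \<Psi> = \<Psi>, OF cl eq, of n xs] j[OF n] xs by simp
  qed
qed

lemma tensor_lift_comp:
  "tensor_lift scale l m G \<Longrightarrow> tensor_lift scale k l H \<Longrightarrow> tensor_lift scale k m (\<lambda>p. G (H p))"
  by (auto simp: tensor_lift_def intro: free_linear_comp[of G H])

lemma tensor_lift_scale:
  "tensor_lift scale k l G \<Longrightarrow> tensor_lift scale k l (\<lambda>p. free_scale c (G p))"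
  by (auto simp: tensor_lift_def intro: free_linear_scale free_tensors_closed free.span_scale)

lemma tensor_lift_diff:
  "tensor_lift scale k l G \<Longrightarrow> tensor_lift scale k l H \<Longrightarrow> tensor_lift scale k l (\<lambda>p. G p - H p)"
  by (auto simp: tensor_lift_def intro: free_linear_diff free_tensors_closed free.span_diff)

lemma tensor_lift_sum:
  "(\<And>x. x \<in> S \<Longrightarrow> tensor_lift scale k l (G x)) \<Longrightarrow> tensor_lift scale k l (\<lambda>p. \<Sum>x\<in>S. G x p)"
  by (auto simp: tensor_lift_def intro!: free_linear_sum free.span_sum
      free.subspace_sum[OF subspace_free_tensors])

section \<open>Overlapping blocks\<close>

text \<open>
  The weight of a term is \<open>-1\<close> when both inequalities hold, that is for \<open>k = l = 0\<close> and \<open>a = b\<close>: an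
  empty block at the place of an empty block lies both to its left and to its right, and the term is
  counted twice among the commuting ones.
\<close>

definition overlap_weight :: "nat \<Rightarrow> nat \<Rightarrow> nat \<Rightarrow> nat \<Rightarrow> 'a::field" where
  "overlap_weight k l a b = 1 - of_bool (a + k \<le> b) - of_bool (b + l \<le> a)"

text \<open>
  One representative for each translation class of pairs of non-zero weight; the union of the
  intervals \<open>[a, a + k)\<close> and \<open>[b, b + l)\<close> has \<open>k + l - s\<close> elements.
\<close>

definition overlap_pairs :: "nat \<Rightarrow> nat \<Rightarrow> nat \<Rightarrow> (nat \<times> nat) set" where
  "overlap_pairs k l s =
     {(a, b). min a b = 0 \<and> (a + k \<le> b \<longleftrightarrow> b + l \<le> a) \<and> max (a + k) (b + l) + s = k + l}"

text \<open>Lift of the share of \<open>\<Psi>3 s\<close> in which \<open>G2\<close> acts before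
  \<open>G1\<close>. The interval at \<open>a\<close> is the input of \<open>G1\<close> and the one
  at \<open>b\<close> the output of \<open>G2\<close>, whence \<open>k1\<close> and
  \<open>l2\<close>.\<close>

definition overlap_map ::
    "nat \<Rightarrow> (('b list \<Rightarrow>\<^sub>0 'a::field) \<Rightarrow> ('b list \<Rightarrow>\<^sub>0 'a)) \<Rightarrow>
       nat \<Rightarrow> nat \<Rightarrow> (('b list \<Rightarrow>\<^sub>0 'a) \<Rightarrow> ('b list \<Rightarrow>\<^sub>0 'a)) \<Rightarrow> nat \<Rightarrow>
       ('b list \<Rightarrow>\<^sub>0 'a) \<Rightarrow> ('b list \<Rightarrow>\<^sub>0 'a)" where
  "overlap_map k1 G1 k2 l2 G2 s p =
     (\<Sum>x\<in>overlap_pairs k1 l2 s. free_scale (overlap_weight k1 l2 (fst x) (snd x))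
        (block_map (fst x) k1 G1 (block_map (snd x) k2 G2 p)))"

lemma finite_overlap_pairs: "finite (overlap_pairs k l s)"
  by (rule finite_subset[of _ "{..l} \<times> {..k}"]) (auto simp: overlap_pairs_def)

text \<open>For \<open>K = k1 + k2 - s\<close>, \<open>k = k1\<close> and \<open>l = l2\<close>,
  these bounds keep the input of \<open>G2\<close> among the \<open>K\<close> factors and the input
  of \<open>G1\<close> among the \<open>K - k2 + l2\<close> factors left by
  \<open>G2\<close>.\<close>

lemma overlap_pairs_bounds:
  assumes "x \<in> overlap_pairs k l s"
  shows "fst x + s \<le> l" "snd x + s \<le> k"
  using assms by (auto simp: overlap_pairs_def)

text \<open>Each term passes from degree \<open>k1 + k2 - s\<close> through
  \<open>k1 + l2 - s\<close> to \<open>l1 + l2 - s\<close>. For \<open>s > min k1 l2\<close> there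
  are no pairs and the map is zero.\<close>

lemma tensor_lift_overlap_map:
  assumes G1: "tensor_lift scale k1 l1 G1" and G2: "tensor_lift scale k2 l2 G2"
  shows "tensor_lift scale (k1 + k2 - s) (l1 + l2 - s) (overlap_map k1 G1 k2 l2 G2 s)"
  unfolding overlap_map_def
proof (intro tensor_lift_sum tensor_lift_scale)
  fix x assume "x \<in> overlap_pairs k1 l2 s"
  then have x: "fst x + s \<le> l2" "snd x + s \<le> k1"
    by (rule overlap_pairs_bounds)+
  have "tensor_lift scale (k1 + k2 - s) (k1 + k2 - s - k2 + l2) (block_map (snd x) k2 G2)"
    using x by (intro tensor_lift_block_map[OF G2]) simp
  moreover have "tensor_lift scale (k1 + k2 - s - k2 + l2) (k1 + k2 - s - k2 + l2 - k1 + l1)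
      (block_map (fst x) k1 G1)"
    using x by (intro tensor_lift_block_map[OF G1]) simp
  moreover have "k1 + k2 - s - k2 + l2 - k1 + l1 = l1 + l2 - s"
    using x by simp
  ultimately show "tensor_lift scale (k1 + k2 - s) (l1 + l2 - s)
      (\<lambda>p. block_map (fst x) k1 G1 (block_map (snd x) k2 G2 p))"
    by (metis tensor_lift_comp)
qed

section \<open>Expansion of a composition of two insertions\<close>

definition separated_sum ::
    "nat \<Rightarrow> (('b list \<Rightarrow>\<^sub>0 'a::field) \<Rightarrow> ('b list \<Rightarrow>\<^sub>0 'a)) \<Rightarrow>
       nat \<Rightarrow> (('b list \<Rightarrow>\<^sub>0 'a) \<Rightarrow> ('b list \<Rightarrow>\<^sub>0 'a)) \<Rightarrow> nat \<Rightarrow>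
       ('b list \<Rightarrow>\<^sub>0 'a) \<Rightarrow> ('b list \<Rightarrow>\<^sub>0 'a)" where
  "separated_sum k1 G1 k2 G2 N p =
     (\<Sum>(i, j)\<in>{(i, j). i + k1 \<le> j \<and> j + k2 \<le> N}. block_map i k1 G1 (block_map j k2 G2 p))"

text \<open>A pair is determined by its overlap \<open>s\<close>, the translation \<open>m\<close>
  and its representative; a window of \<open>k1 + k2 - s\<close> factors has
  \<open>N - (k1 + k2 - s) + 1\<close> positions. The bound \<open>S\<close> is left open so that
  both orders of composition can share it.\<close>

lemma sum_pairs_by_overlap:
  fixes f :: "nat \<Rightarrow> nat \<Rightarrow> 'c::comm_monoid_add"
  assumes N: "k1 + k2 \<le> N" and S: "min k1 l2 \<le> S"
  shows "(\<Sum>(i, j)\<in>{(i, j). i < N - k2 + l2 - k1 + 1 \<and> j < N - k2 + 1 \<and>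
            (i + k1 \<le> j \<longleftrightarrow> j + l2 \<le> i)}. f i j) =
    (\<Sum>s<S + 1. \<Sum>m<N - (k1 + k2 - s) + 1. \<Sum>x\<in>overlap_pairs k1 l2 s. f (m + fst x) (m + snd x))"
proof -
  define m where "m x = min (fst x) (snd x)" for x :: "nat \<times> nat"
  \<comment> \<open>After translation the union of the two intervals starts at 0 and the
    \<open>max\<close> is its length, so the first component is the number of shared
    factors.\<close>
  define w where "w x = (k1 + l2 - (max (fst x - m x + k1) (snd x - m x + l2)), m x,
    (fst x - m x, snd x - m x))" for x :: "nat \<times> nat"
  let ?P = "{(i, j). i < N - k2 + l2 - k1 + 1 \<and> j < N - k2 + 1 \<and> (i + k1 \<le> j \<longleftrightarrow> j + l2 \<le> i)}"
  let ?Q = "SIGMA s:{..<S + 1}. {..<N - (k1 + k2 - s) + 1} \<times> overlap_pairs k1 l2 s"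
  have "(\<Sum>(i, j)\<in>?P. f i j) = (\<Sum>(s, m, x)\<in>?Q. f (m + fst x) (m + snd x))"
  proof (rule sum.reindex_bij_witness[where i = "\<lambda>(s, m, x). (m + fst x, m + snd x)" and j = w])
    fix x assume x: "x \<in> ?P"
    obtain i j where ij: "x = (i, j)" by (cases x)
    show "w x \<in> ?Q"
      using x N S unfolding ij w_def m_def overlap_pairs_def
      by (auto simp: min_def max_def split: if_splits)
    show "(case w x of (s, m, x) \<Rightarrow> (m + fst x, m + snd x)) = x"
      "(case w x of (s, m, x) \<Rightarrow> f (m + fst x) (m + snd x)) = (case x of (i, j) \<Rightarrow> f i j)"
      by (simp_all add: ij w_def m_def)
  next
    fix y assume y: "y \<in> ?Q"
    obtain s n a b where y': "y = (s, n, (a, b))" by (metis prod.exhaust)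
    show "w (case y of (s, m, x) \<Rightarrow> (m + fst x, m + snd x)) = y"
      using y unfolding y' w_def m_def overlap_pairs_def
      by (auto simp: min_def max_def split: if_splits)
    show "(case y of (s, m, x) \<Rightarrow> (m + fst x, m + snd x)) \<in> ?P"
      using y N unfolding y' overlap_pairs_def
      by (auto simp: min_def max_def split: if_splits)
  qed
  then show ?thesis
    by (simp add: sum.Sigma finite_overlap_pairs split_def del: sum.lessThan_Suc)
qed

text \<open>The two separated sums together are symmetric under exchange of the maps, so all
  asymmetry sits in the overlap terms.\<close>

lemma block_map_composition:
  fixes p :: "'b list \<Rightarrow>\<^sub>0 'a::field"
  assumes c1: "\<And>q. q \<in> free_tensors k1 \<Longrightarrow> G1 q \<in> free_tensors l1"
    and c2: "\<And>q. q \<in> free_tensors k2 \<Longrightarrow> G2 q \<in> free_tensors l2"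
    and N: "k1 + k2 \<le> N" and S: "min k1 l2 \<le> S" and p: "p \<in> free_tensors N"
  shows "(\<Sum>i<N - k2 + l2 - k1 + 1. block_map i k1 G1 (\<Sum>j<N - k2 + 1. block_map j k2 G2 p)) =
    separated_sum k1 G1 k2 G2 N p + separated_sum k2 G2 k1 G1 N p +
    (\<Sum>s<S + 1. \<Sum>m<N - (k1 + k2 - s) + 1.
       block_map m (k1 + k2 - s) (overlap_map k1 G1 k2 l2 G2 s) p)"
proof -
  define f where "f i j = block_map i k1 G1 (block_map j k2 G2 p)" for i j
  define w :: "nat \<Rightarrow> nat \<Rightarrow> 'a" where "w = overlap_weight k1 l2"
  \<comment> \<open>\<open>j\<close> is a position in the input, \<open>i\<close> one in the list of
    length \<open>N - k2 + l2\<close> produced by \<open>G2\<close>.\<close>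
  define I where "I = {..<N - k2 + l2 - k1 + 1} \<times> {..<N - k2 + 1}"
  have fin: "finite I" by (simp add: I_def)
  \<comment> \<open>The weight is defined so that it and the two indicators add up to 1.\<close>
  have split: "f i j = (if i + k1 \<le> j then f i j else 0) + (if j + l2 \<le> i then f i j else 0) +
      free_scale (w i j) (f i j)" for i j
    by (simp add: w_def overlap_weight_def free.scale_left_diff_distrib)
  have "(\<Sum>i<N - k2 + l2 - k1 + 1. block_map i k1 G1 (\<Sum>j<N - k2 + 1. block_map j k2 G2 p)) =
      (\<Sum>(i, j)\<in>I. f i j)"
    by (simp add: f_def I_def free_linear_simps[OF free_linear_block_map] sum.cartesian_product
        del: sum.lessThan_Suc)
  also have "\<dots> = (\<Sum>(i, j)\<in>I. if i + k1 \<le> j then f i j else 0) +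
      (\<Sum>(i, j)\<in>I. if j + l2 \<le> i then f i j else 0) + (\<Sum>(i, j)\<in>I. free_scale (w i j) (f i j))"
    by (subst split) (simp add: split_def sum.distrib)
  \<comment> \<open>To the left of its output, \<open>G2\<close> changes nothing, so
    \<open>i\<close> is a position in the input as well.\<close>
  also have "(\<Sum>(i, j)\<in>I. if i + k1 \<le> j then f i j else 0) = separated_sum k1 G1 k2 G2 N p"
    unfolding separated_sum_def f_def[symmetric] using N
    by (intro sum.mono_neutral_cong_right[OF fin]) (auto simp: I_def split: if_splits)
  also have "(\<Sum>(i, j)\<in>I. if j + l2 \<le> i then f i j else 0) =
      (\<Sum>(i, j)\<in>{(i, j)\<in>I. j + l2 \<le> i}. f i j)"
    by (intro sum.mono_neutral_cong_right[OF fin]) (auto split: if_splits)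
  \<comment> \<open>To the right, position \<open>i\<close> after \<open>G2\<close> is position
    \<open>i - l2 + k2\<close> in the input, and \<open>block_map_commute\<close> with exchanged
    roles lets \<open>G1\<close> act first.\<close>
  also have "\<dots> = separated_sum k2 G2 k1 G1 N p"
    unfolding separated_sum_def
  proof (rule sum.reindex_bij_witness[where i = "\<lambda>(j, i). (i - k2 + l2, j)"
        and j = "\<lambda>(i, j). (j, i - l2 + k2)"])
    fix x assume x: "x \<in> {(i, j)\<in>I. j + l2 \<le> i}"
    then obtain i j where ij: "x = (i, j)" "j + l2 \<le> i" "i < N - k2 + l2 - k1 + 1" "j < N - k2 + 1"
      by (auto simp: I_def)
    have "block_map j k2 G2 (block_map (i - l2 + k2) k1 G1 p) = f i j"
      using block_map_commute[where ?G1.0 = G2 and ?G2.0 = G1 and i = j and j = "i - l2 + k2", OF c2 _ _ p]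
        ij(2-) N by (simp add: f_def)
    then show "(case case x of (i, j) \<Rightarrow> (j, i - l2 + k2) of
        (i, j) \<Rightarrow> block_map i k2 G2 (block_map j k1 G1 p)) = (case x of (i, j) \<Rightarrow> f i j)"
      by (simp add: ij(1))
  qed (use N in \<open>auto simp: I_def\<close>)
  \<comment> \<open>The weight vanishes when exactly one of the two inequalities holds.\<close>
  also have "(\<Sum>(i, j)\<in>I. free_scale (w i j) (f i j)) =
      (\<Sum>(i, j)\<in>{(i, j). i < N - k2 + l2 - k1 + 1 \<and> j < N - k2 + 1 \<and>
            (i + k1 \<le> j \<longleftrightarrow> j + l2 \<le> i)}. free_scale (w i j) (f i j))"
    by (intro sum.mono_neutral_cong_right[OF fin]) (auto simp: I_def w_def overlap_weight_def)
  also have "\<dots> = (\<Sum>s<S + 1. \<Sum>m<N - (k1 + k2 - s) + 1. \<Sum>x\<in>overlap_pairs k1 l2 s.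
      free_scale (w (m + fst x) (m + snd x)) (f (m + fst x) (m + snd x)))"
    by (rule sum_pairs_by_overlap[OF N S])
  also have "\<dots> = (\<Sum>s<S + 1. \<Sum>m<N - (k1 + k2 - s) + 1.
       block_map m (k1 + k2 - s) (overlap_map k1 G1 k2 l2 G2 s) p)"
  proof (intro sum.cong refl)
    fix s m assume m: "m \<in> {..<N - (k1 + k2 - s) + 1}"
    have "block_map m (k1 + k2 - s) (overlap_map k1 G1 k2 l2 G2 s) p =
        (\<Sum>x\<in>overlap_pairs k1 l2 s. free_scale (w (fst x) (snd x))
          (block_map m (k1 + k2 - s)
            (\<lambda>p. block_map (fst x) k1 G1 (block_map (snd x) k2 G2 p)) p))"
      unfolding overlap_map_def w_def by (rule block_map_scaled_sum)
    also have "\<dots> = (\<Sum>x\<in>overlap_pairs k1 l2 s.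
        free_scale (w (m + fst x) (m + snd x)) (f (m + fst x) (m + snd x)))"
    proof (intro sum.cong refl)
      fix x assume "x \<in> overlap_pairs k1 l2 s"
      then have x: "fst x + s \<le> l2" "snd x + s \<le> k1"
        by (rule overlap_pairs_bounds)+
      have "block_map m (k1 + k2 - s) (\<lambda>p. block_map (fst x) k1 G1 (block_map (snd x) k2 G2 p)) p =
          f (m + fst x) (m + snd x)"
        unfolding f_def using x m N
        by (intro block_map_nested[where ?G2.0 = G2, OF c2 _ _ _ p]) auto
      \<comment> \<open>The weight only compares the two positions, so it is invariant under
        translation.\<close>
      moreover have "w (fst x) (snd x) = w (m + fst x) (m + snd x)"
        by (simp add: w_def overlap_weight_def add.assoc)
      ultimately show "free_scale (w (fst x) (snd x)) (block_map m (k1 + k2 - s)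
            (\<lambda>p. block_map (fst x) k1 G1 (block_map (snd x) k2 G2 p)) p) =
          free_scale (w (m + fst x) (m + snd x)) (f (m + fst x) (m + snd x))"
        by simp
    qed
    finally show "(\<Sum>x\<in>overlap_pairs k1 l2 s.
        free_scale (w (m + fst x) (m + snd x)) (f (m + fst x) (m + snd x))) =
      block_map m (k1 + k2 - s) (overlap_map k1 G1 k2 l2 G2 s) p" by simp
  qed
  finally show ?thesis .
qed

section \<open>The commutator of two insertions\<close>

theorem mainTheorem1:
  fixes scale :: "'a::field \<Rightarrow> 'b::ab_group_add \<Rightarrow> 'b"
    and k1 l1 k2 l2 :: nat
    and \<Psi>1 \<Psi>2 :: "('b list \<Rightarrow>\<^sub>0 'a) set \<Rightarrow> ('b list \<Rightarrow>\<^sub>0 'a) set"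
  assumes "vector_space scale"
    and "tensor_linear scale k1 l1 \<Psi>1"
    and "tensor_linear scale k2 l2 \<Psi>2"
  shows "\<exists>\<Psi>3 :: nat \<Rightarrow> ('b list \<Rightarrow>\<^sub>0 'a) set \<Rightarrow> ('b list \<Rightarrow>\<^sub>0 'a) set.
     (\<forall>s \<le> min (k1 + k2) (l1 + l2). tensor_linear scale (k1 + k2 - s) (l1 + l2 - s) (\<Psi>3 s)) \<and>
     (\<exists>N0 \<ge> k1 + k2. \<forall>N \<ge> N0. \<forall>A \<in> tensor_power scale N.
        tensor_diff scale (N - k1 - k2 + l1 + l2)
          (insertion scale k1 l1 \<Psi>1 (N - k2 + l2) (insertion scale k2 l2 \<Psi>2 N A))
          (insertion scale k2 l2 \<Psi>2 (N - k1 + l1) (insertion scale k1 l1 \<Psi>1 N A)) =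
        tensor_sum scale (N - k1 - k2 + l1 + l2)
          (\<lambda>s. insertion scale (k1 + k2 - s) (l1 + l2 - s) (\<Psi>3 s) N A)
          (min (k1 + k2) (l1 + l2) + 1))"
proof -
  \<comment> \<open>One bound for both orders: it dominates the largest overlaps
    \<open>min k1 l2\<close> and \<open>min k2 l1\<close>.\<close>
  define S where "S = min (k1 + k2) (l1 + l2)"
  obtain G1 where G1: "tensor_lift scale k1 l1 G1"
    and eq1: "\<And>p. p \<in> free_tensors k1 \<Longrightarrow> \<Psi>1 (tensor_class scale k1 p) = tensor_class scale l1 (G1 p)"
    using tensor_lift_exists[OF assms(2)] by blast
  obtain G2 where G2: "tensor_lift scale k2 l2 G2"
    and eq2: "\<And>p. p \<in> free_tensors k2 \<Longrightarrow> \<Psi>2 (tensor_class scale k2 p) = tensor_class scale l2 (G2 p)"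
    using tensor_lift_exists[OF assms(3)] by blast
  have c1: "\<And>q. q \<in> free_tensors k1 \<Longrightarrow> G1 q \<in> free_tensors l1"
    and c2: "\<And>q. q \<in> free_tensors k2 \<Longrightarrow> G2 q \<in> free_tensors l2"
    using G1 G2 by (auto simp: tensor_lift_def)
  \<comment> \<open>The overlap terms of the two orders of composition enter with opposite
    signs.\<close>
  define X where "X s p = overlap_map k1 G1 k2 l2 G2 s p - overlap_map k2 G2 k1 l1 G1 s p" for s p
  define \<Psi>3 where "\<Psi>3 s = induced_map scale (l1 + l2 - s) (X s)" for s
  have X: "tensor_lift scale (k1 + k2 - s) (l1 + l2 - s) (X s)" for s
    unfolding X_def
    using tensor_lift_overlap_map[OF G1 G2, of s] tensor_lift_overlap_map[OF G2 G1, of s]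
    by (intro tensor_lift_diff) (simp_all add: add.commute)
  have cX: "\<And>q. q \<in> free_tensors (k1 + k2 - s) \<Longrightarrow> X s q \<in> free_tensors (l1 + l2 - s)" for s
    using X[of s] by (auto simp: tensor_lift_def)
  have \<Psi>3: "tensor_linear scale (k1 + k2 - s) (l1 + l2 - s) (\<Psi>3 s)" for s
    unfolding \<Psi>3_def by (rule tensor_linear_induced_map[OF X])
  \<comment> \<open>The threshold \<open>k1 + k2\<close> suffices: the subtractions of
    \<open>k1\<close> and \<open>k2\<close> from \<open>N\<close> are then exact, and every window
    of \<open>k1 + k2 - s\<close> factors fits.\<close>
  have main: "tensor_diff scale (N - k1 - k2 + l1 + l2)
      (insertion scale k1 l1 \<Psi>1 (N - k2 + l2) (insertion scale k2 l2 \<Psi>2 N A))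
      (insertion scale k2 l2 \<Psi>2 (N - k1 + l1) (insertion scale k1 l1 \<Psi>1 N A)) =
    tensor_sum scale (N - k1 - k2 + l1 + l2)
      (\<lambda>s. insertion scale (k1 + k2 - s) (l1 + l2 - s) (\<Psi>3 s) N A) (S + 1)"
    if N: "k1 + k2 \<le> N" and A: "A \<in> tensor_power scale N" for N A
  proof -
    let ?n = "N - k1 - k2 + l1 + l2"
    obtain p where p: "p \<in> free_tensors N" and A_eq: "A = tensor_class scale N p"
      using A by (rule tensor_power_cases)
    define q1 where "q1 = (\<Sum>j<N - k1 + 1. block_map j k1 G1 p)"
    define q2 where "q2 = (\<Sum>j<N - k2 + 1. block_map j k2 G2 p)"
    define q12 where "q12 = (\<Sum>i<N - k2 + l2 - k1 + 1. block_map i k1 G1 q2)"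
    define q21 where "q21 = (\<Sum>i<N - k1 + l1 - k2 + 1. block_map i k2 G2 q1)"
    define q3 where "q3 s = (\<Sum>m<N - (k1 + k2 - s) + 1. block_map m (k1 + k2 - s) (X s) p)" for s
    have closed: "(\<Sum>j<M - k + 1. block_map j k G q) \<in> free_tensors (M - k + l)"
      if "\<And>q. q \<in> free_tensors k \<Longrightarrow> G q \<in> free_tensors l" "k \<le> M" "q \<in> free_tensors M"
      for k l M G and q :: "'b list \<Rightarrow>\<^sub>0 'a"
      using that(2) by (intro free.subspace_sum[OF subspace_free_tensors]
          block_map_closed[where G = G, OF that(1) _ that(3)]) auto
    have F: "q1 \<in> free_tensors (N - k1 + l1)" "q2 \<in> free_tensors (N - k2 + l2)"
      unfolding q1_def q2_def using N p by (intro closed c1 c2; simp)+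
    have n: "N - k2 + l2 - k1 + l1 = ?n" "N - k1 + l1 - k2 + l2 = ?n" using N by auto
    have le: "k1 \<le> N - k2 + l2" "k2 \<le> N - k1 + l1" "k1 \<le> N" "k2 \<le> N" "k1 + k2 - s \<le> N" for s
      using N by auto
    have F': "q12 \<in> free_tensors ?n" "q21 \<in> free_tensors ?n"
      using closed[where G = G1 and k = k1, OF c1 le(1) F(2)]
        closed[where G = G2 and k = k2, OF c2 le(2) F(1)]
      unfolding n q12_def q21_def by blast+
    \<comment> \<open>For \<open>s\<close> at most \<open>S\<close> neither subtraction of
      \<open>s\<close> is truncated, so all \<open>\<Psi>3 s\<close> change the degree by the same
      amount.\<close>
    have n3: "N - (k1 + k2 - s) + (l1 + l2 - s) = ?n" if "s < S + 1" for s
      using that N by (auto simp: S_def)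
    have F3: "q3 s \<in> free_tensors ?n" if "s < S + 1" for s
      using closed[where G = "X s" and k = "k1 + k2 - s", OF cX le(5) p]
      unfolding n3[OF that] q3_def by blast
    have "insertion scale k1 l1 \<Psi>1 (N - k2 + l2) (insertion scale k2 l2 \<Psi>2 N A) = tensor_class scale ?n q12"
      using insertion_class[where G = G2, OF assms(3) le(4) c2 eq2 p]
        insertion_class[where G = G1, OF assms(2) le(1) c1 eq1 F(2)]
      unfolding n q12_def q2_def[symmetric] A_eq by (simp only:)
    moreover have "insertion scale k2 l2 \<Psi>2 (N - k1 + l1) (insertion scale k1 l1 \<Psi>1 N A) = tensor_class scale ?n q21"
      using insertion_class[where G = G1, OF assms(2) le(3) c1 eq1 p]
        insertion_class[where G = G2, OF assms(3) le(2) c2 eq2 F(1)]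
      unfolding n q21_def q1_def[symmetric] A_eq by (simp only:)
    moreover have "tensor_sum scale ?n
        (\<lambda>s. insertion scale (k1 + k2 - s) (l1 + l2 - s) (\<Psi>3 s) N A) (S + 1) =
      tensor_class scale ?n (\<Sum>s<S + 1. q3 s)"
    proof (intro tensor_sum_class conjI F3)
      fix s assume s: "s < S + 1"
      have "insertion scale (k1 + k2 - s) (l1 + l2 - s) (\<Psi>3 s) N (tensor_class scale N p) =
          tensor_class scale (N - (k1 + k2 - s) + (l1 + l2 - s)) (q3 s)"
        unfolding q3_def using N induced_map_class[OF X]
        by (intro insertion_class[OF \<Psi>3 _ cX _ p]) (auto simp: \<Psi>3_def)
      then show "insertion scale (k1 + k2 - s) (l1 + l2 - s) (\<Psi>3 s) N A = tensor_class scale ?n (q3 s)"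
        unfolding A_eq n3[OF s] .
    qed
    moreover have "q12 - q21 = (\<Sum>s<S + 1. q3 s)"
    proof -
      have 12: "q12 = separated_sum k1 G1 k2 G2 N p + separated_sum k2 G2 k1 G1 N p +
          (\<Sum>s<S + 1. \<Sum>m<N - (k1 + k2 - s) + 1.
             block_map m (k1 + k2 - s) (overlap_map k1 G1 k2 l2 G2 s) p)"
        unfolding q12_def q2_def
        by (rule block_map_composition[OF c1 c2 N _ p]) (auto simp: S_def)
      \<comment> \<open>The same two separated sums occur here in the other order and cancel in the
        difference.\<close>
      have 21: "q21 = separated_sum k2 G2 k1 G1 N p + separated_sum k1 G1 k2 G2 N p +
          (\<Sum>s<S + 1. \<Sum>m<N - (k2 + k1 - s) + 1.
             block_map m (k2 + k1 - s) (overlap_map k2 G2 k1 l1 G1 s) p)"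
        unfolding q21_def q1_def using N
        by (intro block_map_composition[OF c2 c1 _ _ p]) (auto simp: S_def)
      show ?thesis
        unfolding 12 21 q3_def X_def block_map_diff sum_subtractf by (simp add: add.commute)
    qed
    ultimately show ?thesis
      by (simp only: tensor_diff_class[OF F'])
  qed
  show ?thesis
    using \<Psi>3 main unfolding S_def by (intro exI[of _ \<Psi>3] conjI exI[of _ "k1 + k2"]) auto
qed

end
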